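(* Let $\boldsymbol\mu=\{\mu_t\}_{t>0}$ be a measurable factorizing family over $[0,1]\times L$, with countable ring $\mathcal R\subset\Sigma_1$ as in condition (iv a), and let $\mathbb E^{\boldsymbol\mu}$ be its random-set system. Then $\mathbb E^{\boldsymbol\mu}$ is spatial if and only if there exists a family $\boldsymbol\nu=\{\nu_t\}_{t>0}$ of probability measures on $(\mathscr C_t,\Sigma_t)$ such that (i) $\nu_t\ll\mu_t$ for all $t>0$; (ii) $\nu_{s+t}=(\nu_s\otimes\nu_t)\circ\oplus_{s,t}^{-1}$ for all $s,t>0$; (iii) $t\mapsto(\sigma_t)_*\nu_t(A)$ is Borel on $(0,\infty)$ for every $A\in\mathcal R$.
   Context: Let $L$ be a locally compact, second countable Hausdorff space. For $t>0$ let $\mathscr C_t$ be the space of closed subsets of $[0,t]\times L$ with the Borel $\sigma$-field $\Sigma_t$ of the Fell topology. $\oplus_{s,t}(Z_1,Z_2)=Z_1\cup(s+Z_2)$ with $s+Z_2=\{(s+r,\ell):(r,\ell)\in Z_2\}$; $\sigma_t(Z)=\{(r/t,\ell):(r,\ell)\in Z\}\in\mathscr C_1$. A family of probability measures $\{\mu_t\}$ on $\mathscr C_t$ is a measurable factorizing family over $[0,1]\times L$ if: (i) $\mu_{s+t}\sim(\mu_s\otimes\mu_t)\circ\oplus_{s,t}^{-1}$ (mutual absolute continuity); (ii) $\mu_t(\{Z:Z\cap(\{r\}\times L)\neq\varnothing\})=0$ for all $t>0,r\in[0,t]$; (iii) no $\mu_t$ is supported on finitely many atoms; (iv a) there is a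 countable ring $\mathcal R\subset\Sigma_1$ generating $\Sigma_1$ with $t\mapsto(\sigma_t)_*\mu_t(A)$ Borel for each $A\in\mathcal R$; (iv b) there is a Borel $\Delta:(0,\infty)^2\times\mathscr C_1\to(0,\infty)$ with $\Delta(s,t,\sigma_{s+t}(Z))=\Delta_{s,t}(Z)$ $\mu_{s+t}$-a.e., where $\Delta_{s,t}=d((\mu_s\otimes\mu_t)\circ\oplus_{s,t}^{-1})/d\mu_{s+t}$. The random-set system $\mathbb E^{\boldsymbol\mu}$: $E_t=L^2(\mathscr C_t,\mu_t)$, $U_{s,t}(f\otimes g)(Z)=\Delta_{s,t}(Z)^{1/2}f(Z\cap([0,s]\times L))\,g((Z\cap([s,s+t]\times L))-(s,0))$, with the Borel structure transported via $f\mapsto f\circ\sigma_t^{-1}$ from the measurable field $\{L^2(\mathscr C_1,(\sigma_t)_*\mu_t)\}$ whose measurable structure is generated by the fundamental sections $t\mapsto\mathbf 1_A$, $A\in\mathcal R$; it is an Arveson system. A unit is a nonzero Borel section $t\mapsto u_t\in E_t$ with $u_{s+t}=U_{s,t}(u_s\otimes u_t)$ for all $s,t>0$; the system is spatial if it has a unit. *)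

theory Defs
  imports "HOL-Probability.Probability"
begin

definition Cspace :: "real \<Rightarrow> (real \<times> 'l::topological_space) set set" where
  "Cspace t = {Z. Z \<subseteq> {0..t} \<times> UNIV \<and> closed Z}"

definition Fell_subbasis :: "real \<Rightarrow> (real \<times> 'l::topological_space) set set set" where
  "Fell_subbasis t =
     {{Z \<in> Cspace t. Z \<inter> K = {}} | K. compact K \<and> K \<subseteq> {0..t} \<times> UNIV} \<union>
     {{Z \<in> Cspace t. Z \<inter> U \<noteq> {}} | U. open U}"

definition Fell_topology :: "real \<Rightarrow> (real \<times> 'l::topological_space) set topology" where
  "Fell_topology t = topology_generated_by (Fell_subbasis t)"

definition Cmeas :: "real \<Rightarrow> (real \<times> 'l::topological_space) set measure" where
  "Cmeas t = sigma (Cspace t) {U. openin (Fell_topology t) U}"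

definition shift :: "real \<Rightarrow> (real \<times> 'l) set \<Rightarrow> (real \<times> 'l) set" where
  "shift s Z = (\<lambda>(r, l). (s + r, l)) ` Z"

definition oplus :: "real \<Rightarrow> (real \<times> 'l) set \<times> (real \<times> 'l) set \<Rightarrow> (real \<times> 'l) set" where
  "oplus s ZZ = fst ZZ \<union> shift s (snd ZZ)"

definition rescale :: "real \<Rightarrow> (real \<times> 'l) set \<Rightarrow> (real \<times> 'l) set" where
  "rescale t Z = (\<lambda>(r, l). (r / t, l)) ` Z"

definition left_piece :: "real \<Rightarrow> (real \<times> 'l) set \<Rightarrow> (real \<times> 'l) set" where
  "left_piece s Z = Z \<inter> ({0..s} \<times> UNIV)"

definition right_piece :: "real \<Rightarrow> real \<Rightarrow> (real \<times> 'l) set \<Rightarrow> (real \<times> 'l) set" where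
  "right_piece s t Z = (\<lambda>(r, l). (r - s, l)) ` (Z \<inter> ({s..s+t} \<times> UNIV))"

definition conv :: "real \<Rightarrow> real \<Rightarrow> (real \<times> 'l::topological_space) set measure
     \<Rightarrow> (real \<times> 'l) set measure \<Rightarrow> (real \<times> 'l) set measure" where
  "conv s t M N = distr (M \<Otimes>\<^sub>M N) (Cmeas (s + t)) (oplus s)"

definition Delta :: "(real \<Rightarrow> (real \<times> 'l::topological_space) set measure)
     \<Rightarrow> real \<Rightarrow> real \<Rightarrow> (real \<times> 'l) set \<Rightarrow> real" where
  "Delta \<mu> s t = (\<lambda>Z. enn2real (RN_deriv (\<mu> (s + t)) (conv s t (\<mu> s) (\<mu> t)) Z))"

definition pos_reals :: "real measure" where
  "pos_reals = restrict_space borel {0<..}"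

definition measurable_factorizing_family ::
  "(real \<Rightarrow> (real \<times> 'l::topological_space) set measure) \<Rightarrow> (real \<times> 'l) set set set \<Rightarrow> bool" where
  "measurable_factorizing_family \<mu> R \<longleftrightarrow>
     (\<forall>t>0. prob_space (\<mu> t) \<and> \<mu> t \<in> space (prob_algebra (Cmeas t)))
   \<and> (\<forall>s>0. \<forall>t>0. absolutely_continuous (\<mu> (s + t)) (conv s t (\<mu> s) (\<mu> t))
                 \<and> absolutely_continuous (conv s t (\<mu> s) (\<mu> t)) (\<mu> (s + t)))
   \<and> (\<forall>t>0. \<forall>r\<in>{0..t}. emeasure (\<mu> t) {Z \<in> Cspace t. Z \<inter> ({r} \<times> UNIV) \<noteq> {}} = 0)
   \<and> (\<forall>t>0. \<not> (\<exists>F. finite F \<and> (AE Z in \<mu> t. Z \<in> F)))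
   \<and> (countable R \<and> ring_of_sets (Cspace 1) R \<and> sigma_sets (Cspace 1) R = sets (Cmeas 1)
      \<and> (\<forall>A\<in>R. (\<lambda>t. measure (distr (\<mu> t) (Cmeas 1) (rescale t)) A) \<in> borel_measurable pos_reals))
   \<and> (\<exists>D :: (real \<times> real) \<times> (real \<times> 'l) set \<Rightarrow> real.
        D \<in> borel_measurable ((pos_reals \<Otimes>\<^sub>M pos_reals) \<Otimes>\<^sub>M Cmeas 1)
      \<and> (\<forall>s>0. \<forall>t>0. \<forall>Z\<in>Cspace 1. D ((s, t), Z) > 0)
      \<and> (\<forall>s>0. \<forall>t>0. AE Z in \<mu> (s + t). D ((s, t), rescale (s + t) Z) = Delta \<mu> s t Z))"

text \<open>A section t \<mapsto> u_t \<in> L^2(C_t, mu_t) (complex); u_t is represented by a square-integrable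
representative.  Borel-ness w.r.t. the measurable field structure generated by the fundamental
sections t \<mapsto> 1_A \<circ> sigma_t (A \<in> R): t \<mapsto> <1_A \<circ> sigma_t, u_t> is Borel for all A \<in> R.
The unit equation u_{s+t} = U_{s,t}(u_s \<otimes> u_t) is written out via the defining formula of U_{s,t}
on elementary tensors, as an equality in L^2(mu_{s+t}), i.e. almost everywhere.\<close>
definition is_unit ::
  "(real \<Rightarrow> (real \<times> 'l::topological_space) set measure) \<Rightarrow> (real \<times> 'l) set set set
   \<Rightarrow> (real \<Rightarrow> (real \<times> 'l) set \<Rightarrow> complex) \<Rightarrow> bool" where
  "is_unit \<mu> R u \<longleftrightarrow>
     (\<forall>t>0. u t \<in> borel_measurable (\<mu> t) \<and> integrable (\<mu> t) (\<lambda>Z. (norm (u t Z))\<^sup>2))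
   \<and> (\<forall>A\<in>R. (\<lambda>t. LINT Z|\<mu> t. u t Z * indicator A (rescale t Z)) \<in> borel_measurable pos_reals)
   \<and> (\<forall>s>0. \<forall>t>0. AE Z in \<mu> (s + t).
        u (s + t) Z = complex_of_real (sqrt (Delta \<mu> s t Z))
                      * u s (left_piece s Z) * u t (right_piece s t Z))
   \<and> (\<exists>t>0. \<not> (AE Z in \<mu> t. u t Z = 0))"

definition spatial ::
  "(real \<Rightarrow> (real \<times> 'l::topological_space) set measure) \<Rightarrow> (real \<times> 'l) set set set \<Rightarrow> bool" where
  "spatial \<mu> R \<longleftrightarrow> (\<exists>u. is_unit \<mu> R u)"

end

theory Submission
  imports Defs
begin

text \<open>
  If \<open>u\<close> is a unit, then \<open>|u\<^sub>t|\<^sup>2 \<mu>\<^sub>t\<close>, normalised, is a convolution family; conversely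
  \<open>u\<^sub>t = sqrt (d\<nu>\<^sub>t / d\<mu>\<^sub>t)\<close> is a unit. Both follow from the identity
  \<open>F \<mu>\<^sub>s * H \<mu>\<^sub>t = \<Delta>\<^sub>s\<^sub>,\<^sub>t F(left) H(right) \<mu>\<^sub>s\<^sub>+\<^sub>t\<close>, which uses that the sets almost surely avoid
  fixed times.

  Measurability in \<open>t\<close>: \<open>\<integral>\<^sub>A w\<^sub>t\<^sup>2 d\<rho>\<^sub>t\<close> is the supremum of \<open>2 \<integral>\<^sub>A c w\<^sub>t d\<rho>\<^sub>t - \<integral>\<^sub>A c\<^sup>2 d\<rho>\<^sub>t\<close> over
  countably many functions \<open>c\<close> independent of \<open>t\<close>, so squares, hence by polarisation and Weierstrass
  continuous functions, of bounded Borel sections are Borel. This covers \<open>|u\<^sub>t|\<^sup>2\<close> and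
  \<open>sqrt (d\<nu>\<^sub>t / d\<mu>\<^sub>t)\<close>.

  The ring need not cover the whole space. It can miss a set charged by the measures only if that set
  is empty, and then the point masses at the empty set form a convolution family.
\<close>

section \<open>Measurability with respect to the Fell topology\<close>

text \<open>The sections \<open>u t\<close> live in different spaces, and neither they nor the
  Radon-Nikodym derivatives, chosen separately for each \<open>t\<close>, come with joint
  measurability in \<open>(t, Z)\<close>. Available is only the Borel dependence of integrals over
  fixed sets after rescaling to time \<open>1\<close>. This condition is linear, while both
  directions need a nonlinear operation; hence the detour through suprema. A density may be
  unbounded, so polynomials approximate not its square root but a function of
  \<open>1 / (1 + f)\<close>, which has values in [0,1]. Normalising is harmless: the squared norm
  of a unit is multiplicative in \<open>t\<close>, so dividing by it keeps the convolution identity,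
  and it vanishes at all times or at none, because times can be subdivided. The ring's coverage
  matters because passing to complements needs the integral over the whole space. For the constant
  section \<open>1\<close> this is the total mass; for a unit it has to be recovered as a limit over
  ring sets, and such a limit only reaches the union of the ring.\<close>

lemma Fell_open_subset: "{U. openin (Fell_topology t) U} \<subseteq> Pow (Cspace t)"
proof -
  have "topspace (Fell_topology t) \<subseteq> Cspace t"
    unfolding Fell_topology_def topology_generated_by_topspace by (auto simp: Fell_subbasis_def)
  then show ?thesis
    using openin_subset by blast
qed

lemma space_Cmeas [simp]: "space (Cmeas t) = Cspace t"
  by (simp add: Cmeas_def space_measure_of_conv)

lemma sets_Cmeas: "sets (Cmeas t) = sigma_sets (Cspace t) {U. openin (Fell_topology t) U}"
  unfolding Cmeas_def by (rule sets_measure_of[OF Fell_open_subset])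

lemma Cspace_empty [simp]: "{} \<in> Cspace t"
  by (simp add: Cspace_def)

lemma miss_compact_sets:
  assumes "compact (K :: (real \<times> 'l::t2_space) set)"
  shows "{Z \<in> Cspace t. Z \<inter> K = {}} \<in> sets (Cmeas t)"
proof -
  \<comment> \<open>The subbasis only offers compact sets inside the strip, and an element of
    \<open>Cspace t\<close> cannot meet the rest of \<open>K\<close>.\<close>
  let ?K = "K \<inter> ({0..t} \<times> UNIV)"
  have "compact ?K"
    by (intro compact_Int_closed assms closed_Times) auto
  then have "{Z \<in> Cspace t. Z \<inter> ?K = {}} \<in> Fell_subbasis t"
    unfolding Fell_subbasis_def by blast
  moreover have "{Z \<in> Cspace t. Z \<inter> ?K = {}} = {Z \<in> Cspace t. Z \<inter> K = {}}"
    by (auto simp: Cspace_def)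
  ultimately show ?thesis
    unfolding sets_Cmeas Fell_topology_def
    by (auto intro!: sigma_sets.Basic topology_generated_by_Basis)
qed

lemma strip_compact_nbhd:
  fixes U :: "(real \<times> 'l::t2_space) set"
  assumes lc: "locally_compact_space (euclidean :: 'l topology)"
    and "open U" "x \<in> U"
  obtains V K where "open V" "compact K" "x \<in> V" "V \<subseteq> K" "K \<subseteq> U"
proof -
  have "locally_compact_space (prod_topology (euclidean :: real topology) (euclidean :: 'l topology))"
    unfolding locally_compact_space_prod_topology
    using lc locally_compact_space_euclidean by blast
  then have 1: "locally_compact_space (euclidean :: (real \<times> 'l) topology)"
    by simp
  have "Hausdorff_space (euclidean :: (real \<times> 'l) topology)"
    unfolding Hausdorff_space_def disjnt_def open_openin[symmetric] using hausdorff by blast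
  with 1 have "neighbourhood_base_of (compactin euclidean) (euclidean :: (real \<times> 'l) topology)"
    using locally_compact_space_neighbourhood_base by blast
  then have "\<exists>V K. open V \<and> compact K \<and> x \<in> V \<and> V \<subseteq> K \<and> K \<subseteq> U"
    using assms(2,3) unfolding neighbourhood_base_of by (cases x) simp
  then show ?thesis
    using that by blast
qed

text \<open>Lets a hit condition for an open set be written as a countable union of negated miss
  conditions, so that measurability need only be tested on misses of compact sets. Local compactness
  supplies enough basis sets whose compact closures stay inside \<open>U\<close>.\<close>

lemma open_eq_Union_compact:
  fixes U :: "(real \<times> 'l::{t2_space, second_countable_topology}) set"
  assumes lc: "locally_compact_space (euclidean :: 'l topology)"
    and "open U"
  obtains \<K> where "countable \<K>" "\<And>K. K \<in> \<K> \<Longrightarrow> compact K" "U = \<Union>\<K>"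
proof -
  obtain \<B> :: "(real \<times> 'l) set set" where \<B>: "countable \<B>" "topological_basis \<B>"
    using ex_countable_basis by blast
  define \<K> where "\<K> = {closure V | V. V \<in> \<B> \<and> compact (closure V) \<and> closure V \<subseteq> U}"
  have "countable \<K>"
    by (rule countable_subset[of _ "closure ` \<B>"]) (use \<B> in \<open>auto simp: \<K>_def\<close>)
  moreover have "x \<in> \<Union>\<K>" if x: "x \<in> U" for x
  proof -
    obtain W K where W: "open W" "compact K" "x \<in> W" "W \<subseteq> K" "K \<subseteq> U"
      using strip_compact_nbhd[OF lc assms(2) x] by blast
    obtain V where V: "V \<in> \<B>" "x \<in> V" "V \<subseteq> W"
      using topological_basisE[OF \<B>(2) W(1,3)] by blast
    have "closure V \<subseteq> K"
      using V W by (intro closure_minimal) (auto intro: compact_imp_closed)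
    moreover from this have "compact (closure V)"
      using compact_Int_closed[OF W(2), of "closure V"] by (simp add: Int_absorb1)
    ultimately have "closure V \<in> \<K>"
      using V W unfolding \<K>_def by blast
    then show ?thesis
      using V closure_subset by blast
  qed
  moreover have "\<And>K. K \<in> \<K> \<Longrightarrow> compact K" "\<Union>\<K> \<subseteq> U"
    by (auto simp: \<K>_def)
  ultimately show ?thesis
    using that[of \<K>] by blast
qed

text \<open>\<open>S\<close> need not be compact, but the whole space is a countable union of
  compact sets, each of which cuts \<open>S\<close> in a compact set. The instances of interest are
  the fibre at a fixed time, which is as little compact as the second factor, and the whole space,
  which only the empty set misses.\<close>

lemma hit_closed_sets:
  fixes S :: "(real \<times> 'l::{t2_space, second_countable_topology}) set"
  assumes lc: "locally_compact_space (euclidean :: 'l topology)"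
    and "closed S"
  shows "{Z \<in> Cspace t. Z \<inter> S \<noteq> {}} \<in> sets (Cmeas t)"
    and "{Z \<in> Cspace t. Z \<inter> S = {}} \<in> sets (Cmeas t)"
proof -
  obtain \<K> :: "(real \<times> 'l) set set"
    where \<K>: "countable \<K>" "\<And>K. K \<in> \<K> \<Longrightarrow> compact K" "UNIV = \<Union>\<K>"
    using open_eq_Union_compact[OF lc open_UNIV] by blast
  have "{Z \<in> Cspace t. Z \<inter> S \<noteq> {}} =
      (\<Union>K\<in>\<K>. space (Cmeas t) - {Z \<in> Cspace t. Z \<inter> (K \<inter> S) = {}})"
    using \<K>(3) by auto
  also have "\<dots> \<in> sets (Cmeas t)"
    using \<K> assms by (intro sets.countable_UN'' sets.compl_sets miss_compact_sets) auto
  finally show 1: "{Z \<in> Cspace t. Z \<inter> S \<noteq> {}} \<in> sets (Cmeas t)" .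
  have "{Z \<in> Cspace t. Z \<inter> S = {}} = space (Cmeas t) - {Z \<in> Cspace t. Z \<inter> S \<noteq> {}}"
    by auto
  then show "{Z \<in> Cspace t. Z \<inter> S = {}} \<in> sets (Cmeas t)"
    using sets.compl_sets[OF 1] by simp
qed

text \<open>The Fell topology is second countable: a set in an open \<open>U\<close> lies in a finite intersection
  of hit and miss conditions taken from countable families of open and compact sets.\<close>

lemma measurable_into_Cmeas:
  fixes f :: "'a \<Rightarrow> (real \<times> 'l::{t2_space, second_countable_topology}) set"
  assumes lc: "locally_compact_space (euclidean :: 'l topology)"
    and sp: "\<And>z. z \<in> space M \<Longrightarrow> f z \<in> Cspace t"
    and miss: "\<And>K. compact K \<Longrightarrow> {z \<in> space M. f z \<inter> K = {}} \<in> sets M"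
  shows "f \<in> measurable M (Cmeas t)"
proof -
  obtain \<B> :: "(real \<times> 'l) set set" where \<B>: "countable \<B>" "topological_basis \<B>"
    using ex_countable_basis by blast
  define \<C> where "\<C> = {closure V | V. V \<in> \<B> \<and> compact (closure V)}"
  have \<C>: "countable \<C>"
    by (rule countable_subset[of _ "closure ` \<B>"]) (use \<B> in \<open>auto simp: \<C>_def\<close>)
  define fin :: "(real \<times> 'l) set set \<times> (real \<times> 'l) set set \<Rightarrow> (real \<times> 'l) set set"
    where "fin = (\<lambda>(\<K>, \<V>). {Z \<in> Cspace t. Z \<inter> \<Union>\<K> = {} \<and> (\<forall>V\<in>\<V>. Z \<inter> V \<noteq> {})})"
  define I where "I = {\<K>. \<K> \<subseteq> \<C> \<and> finite \<K>} \<times> {\<V>. \<V> \<subseteq> \<B> \<and> finite \<V>}"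
  have I: "countable I"
    unfolding I_def using \<B> \<C> by (auto intro!: countable_SIGMA countable_Collect_finite_subset
        simp: conj_commute)
  have hit: "{z \<in> space M. f z \<inter> V \<noteq> {}} \<in> sets M" if "open V" for V
  proof -
    obtain \<K> where \<K>: "countable \<K>" "\<And>K. K \<in> \<K> \<Longrightarrow> compact K" "V = \<Union>\<K>"
      using open_eq_Union_compact[OF lc \<open>open V\<close>] by blast
    have "{z \<in> space M. f z \<inter> V \<noteq> {}} = (\<Union>K\<in>\<K>. space M - {z \<in> space M. f z \<inter> K = {}})"
      using \<K>(3) by auto
    also have "\<dots> \<in> sets M"
      using \<K> by (intro sets.countable_UN'' sets.compl_sets miss) auto
    finally show ?thesis .
  qed
  have fin_meas: "f -` fin i \<inter> space M \<in> sets M" if iI: "i \<in> I" for i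
  proof -
    obtain \<K> \<V> where i: "i = (\<K>, \<V>)" "\<K> \<subseteq> \<C>" "finite \<K>" "\<V> \<subseteq> \<B>" "finite \<V>"
      using iI unfolding I_def by blast
    have "f -` fin i \<inter> space M =
        {z \<in> space M. f z \<inter> \<Union>\<K> = {}} \<inter> {z \<in> space M. \<forall>V\<in>\<V>. f z \<inter> V \<noteq> {}}"
      using sp by (auto simp: fin_def i)
    also have "\<dots> \<in> sets M"
    proof (intro sets.Int)
      have "compact (\<Union>\<K>)"
        using i by (intro compact_Union) (auto simp: \<C>_def)
      then show "{z \<in> space M. f z \<inter> \<Union>\<K> = {}} \<in> sets M"
        by (rule miss)
      have "{z \<in> space M. f z \<inter> V \<noteq> {}} \<in> sets M" if "V \<in> \<V>" for V
        using i that \<B> by (intro hit) (auto simp: topological_basis_open)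
      then show "{z \<in> space M. \<forall>V\<in>\<V>. f z \<inter> V \<noteq> {}} \<in> sets M"
        using i by (intro sets.sets_Collect_finite_All) auto
    qed
    finally show ?thesis .
  qed
  have base: "\<exists>i\<in>I. Z \<in> fin i \<and> fin i \<subseteq> U"
    if "generate_topology_on (Fell_subbasis t) U" "Z \<in> U" for U Z
    using that
  proof (induction arbitrary: Z)
    case Empty
    then show ?case by simp
  next
    case (Int U1 U2)
    obtain i1 where 1: "i1 \<in> I" "Z \<in> fin i1" "fin i1 \<subseteq> U1" using Int by blast
    obtain i2 where 2: "i2 \<in> I" "Z \<in> fin i2" "fin i2 \<subseteq> U2" using Int by blast
    have eq: "fin (fst i1 \<union> fst i2, snd i1 \<union> snd i2) = fin i1 \<inter> fin i2"
      by (cases i1; cases i2) (auto simp: fin_def)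
    have mem: "(fst i1 \<union> fst i2, snd i1 \<union> snd i2) \<in> I"
      using 1(1) 2(1) by (auto simp: I_def)
    show "\<exists>i\<in>I. Z \<in> fin i \<and> fin i \<subseteq> U1 \<inter> U2"
      by (rule bexI[OF _ mem]) (unfold eq, use 1 2 in blast)
  next
    case (UN \<U>)
    then obtain U where "U \<in> \<U>" "Z \<in> U" by blast
    with UN.IH[OF this] show ?case by (meson Union_upper subset_trans)
  next
    case (Basis U)
    then consider (miss) K where "compact K" "U = {Z \<in> Cspace t. Z \<inter> K = {}}"
      | (hit) V where "open V" "U = {Z \<in> Cspace t. Z \<inter> V \<noteq> {}}"
      by (auto simp: Fell_subbasis_def)
    then show ?case
    proof cases
      case hit
      then obtain x where x: "x \<in> Z" "x \<in> V" using Basis by auto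
      obtain V' where V': "V' \<in> \<B>" "x \<in> V'" "V' \<subseteq> V"
        using topological_basisE[OF \<B>(2) hit(1) x(2)] by blast
      have "({}, {V'}) \<in> I" using V' by (auto simp: I_def)
      moreover have "Z \<in> fin ({}, {V'})" "fin ({}, {V'}) \<subseteq> U"
        using V' x Basis hit by (auto simp: fin_def)
      ultimately show ?thesis by blast
    next
      case miss
      have Z: "Z \<in> Cspace t" "Z \<inter> K = {}" using miss Basis by auto
      then have op: "open (- Z)" by (auto simp: Cspace_def)
      \<comment> \<open>Basis sets whose compact closures still avoid \<open>Z\<close>. They cover
        \<open>K\<close>, finitely many suffice, and every set missing their closures misses
        \<open>K\<close>. This replaces the arbitrary compact \<open>K\<close> by a condition from
        the countable family \<open>I\<close>.\<close>
      define \<F> where "\<F> = {V \<in> \<B>. compact (closure V) \<and> closure V \<subseteq> - Z}"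
      have "K \<subseteq> \<Union>\<F>"
      proof
        fix x assume "x \<in> K"
        then have "x \<in> - Z" using Z by auto
        then obtain W C where W: "open W" "compact C" "x \<in> W" "W \<subseteq> C" "C \<subseteq> - Z"
          using strip_compact_nbhd[OF lc op] by blast
        obtain V where V: "V \<in> \<B>" "x \<in> V" "V \<subseteq> W"
          using topological_basisE[OF \<B>(2) W(1,3)] by blast
        have "closure V \<subseteq> C"
          using V W by (intro closure_minimal) (auto intro: compact_imp_closed)
        moreover from this have "compact (closure V)"
          using compact_Int_closed[OF W(2), of "closure V"] by (simp add: Int_absorb1)
        ultimately have "V \<in> \<F>"
          using V W unfolding \<F>_def by blast
        then show "x \<in> \<Union>\<F>" using V by blast
      qed
      moreover have "\<And>V. V \<in> \<F> \<Longrightarrow> open V"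
        using \<B> by (auto simp: \<F>_def topological_basis_open)
      ultimately have "\<exists>\<F>'\<subseteq>\<F>. finite \<F>' \<and> K \<subseteq> \<Union>\<F>'"
        using \<open>compact K\<close> unfolding compact_eq_Heine_Borel by simp
      then obtain \<F>' where \<F>': "\<F>' \<subseteq> \<F>" "finite \<F>'" "K \<subseteq> \<Union>\<F>'"
        by blast
      have "K \<subseteq> \<Union>(closure ` \<F>')"
        using \<F>'(3) closure_subset by blast
      then have "fin (closure ` \<F>', {}) \<subseteq> U" 
        unfolding miss fin_def by auto
      moreover have "Z \<in> fin (closure ` \<F>', {})"
        using \<F>'(1) Z by (auto simp: fin_def \<F>_def)
      moreover have "(closure ` \<F>', {}) \<in> I"
        using \<F>' by (auto simp: I_def \<F>_def \<C>_def)
      ultimately show ?thesis by blast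
    qed
  qed
  have "f -` U \<inter> space M \<in> sets M" if "openin (Fell_topology t) U" for U
  proof -
    have gen: "generate_topology_on (Fell_subbasis t) U"
      using that by (simp add: Fell_topology_def openin_topology_generated_by_iff)
    have "f -` U \<inter> space M = (\<Union>i\<in>{i \<in> I. fin i \<subseteq> U}. f -` fin i \<inter> space M)"
    proof (intro equalityI subsetI)
      fix z assume z: "z \<in> f -` U \<inter> space M"
      then obtain i where "i \<in> I" "f z \<in> fin i" "fin i \<subseteq> U"
        using base[OF gen, of "f z"] by auto
      with z show "z \<in> (\<Union>i\<in>{i \<in> I. fin i \<subseteq> U}. f -` fin i \<inter> space M)"
        by blast
    qed blast
    also have "\<dots> \<in> sets M"
      using I fin_meas by (intro sets.countable_UN'') auto
    finally show ?thesis .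
  qed
  then show ?thesis
    unfolding Cmeas_def using sp by (intro measurable_measure_of[OF Fell_open_subset]) auto
qed

section \<open>Affine changes of time and the maps between the spaces of closed sets\<close>

definition time_affine :: "real \<Rightarrow> real \<Rightarrow> real \<times> 'l \<Rightarrow> real \<times> 'l" where
  "time_affine a b = (\<lambda>(r, l). (a * r + b, l))"

lemma continuous_on_time_affine [continuous_intros]:
  "continuous_on A (time_affine a b :: real \<times> 'l::topological_space \<Rightarrow> real \<times> 'l)"
  unfolding time_affine_def split_def by (intro continuous_intros)

lemma time_affine_image_eq_vimage:
  assumes "a \<noteq> 0"
  shows "time_affine a b ` A = time_affine (1 / a) (- b / a) -` A"
proof (intro equalityI subsetI)
  fix p assume "p \<in> time_affine (1 / a) (- b / a) -` A"
  moreover have "p = time_affine a b (time_affine (1 / a) (- b / a) p)"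
    using assms by (cases p) (simp add: time_affine_def field_simps)
  ultimately show "p \<in> time_affine a b ` A" by blast
qed (use assms in \<open>auto simp: time_affine_def field_simps\<close>)

lemma compact_time_affine_image:
  "compact (A :: (real \<times> 'l::topological_space) set) \<Longrightarrow> compact (time_affine a b ` A)"
  by (intro compact_continuous_image continuous_on_time_affine)

lemma closed_time_affine_image:
  assumes "a \<noteq> 0" "closed (A :: (real \<times> 'l::topological_space) set)"
  shows "closed (time_affine a b ` A)"
  unfolding time_affine_image_eq_vimage[OF assms(1)]
  by (intro closed_vimage assms(2) continuous_on_time_affine)

text \<open>Moves a change of time from the random set to the test set. Compact sets stay compact,
  so the preimage of a miss condition is again a miss condition, which is what
  \<open>measurable_into_Cmeas\<close> asks for.\<close>

lemma time_affine_image_disjoint: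
  assumes "a \<noteq> 0"
  shows "time_affine a b ` Z \<inter> K = {} \<longleftrightarrow> Z \<inter> time_affine (1 / a) (- b / a) ` K = {}"
proof -
  have "time_affine (1 / a) (- b / a) ` K = time_affine a b -` K"
    using time_affine_image_eq_vimage[of "1 / a" "- b / a" K] assms by simp
  then show ?thesis by auto
qed

lemma shift_eq: "shift s Z = time_affine 1 s ` Z"
  by (simp add: shift_def time_affine_def add.commute)

lemma rescale_eq: "rescale t Z = time_affine (1 / t) 0 ` Z"
  by (simp add: rescale_def time_affine_def)

lemma right_piece_eq: "right_piece s t Z = time_affine 1 (- s) ` (Z \<inter> ({s..s+t} \<times> UNIV))"
  by (simp add: right_piece_def time_affine_def)

lemma rescale_in_Cspace:
  assumes "t > 0" "Z \<in> Cspace (c * t)"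
  shows "rescale t Z \<in> Cspace c"
  using assms closed_time_affine_image[of "1 / t" Z 0]
  by (auto simp: Cspace_def rescale_eq time_affine_def field_simps)

lemma rescale_inverse:
  assumes "t > 0"
  shows "rescale (1 / t) (rescale t Z) = Z" "rescale t (rescale (1 / t) Z) = Z"
  using assms by (auto simp: rescale_def image_image split_def)

lemma oplus_in_Cspace:
  assumes "s > 0" "t > 0" "Z1 \<in> Cspace s" "Z2 \<in> Cspace t"
  shows "oplus s (Z1, Z2) \<in> Cspace (s + t)"
  using assms closed_time_affine_image[of 1 Z2 s]
  by (auto simp: Cspace_def oplus_def shift_eq time_affine_def)

text \<open>A union misses \<open>K\<close> exactly when both parts do, so the preimage of a miss
  condition is a rectangle of miss conditions.\<close>

lemma measurable_oplus:
  assumes lc: "locally_compact_space (euclidean :: 'l::{t2_space, second_countable_topology} topology)"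
    and "s > 0" "t > 0"
  shows "oplus s \<in> measurable (Cmeas s \<Otimes>\<^sub>M (Cmeas t :: (real \<times> 'l) set measure)) (Cmeas (s + t))"
proof (rule measurable_into_Cmeas[OF lc])
  fix K :: "(real \<times> 'l) set" assume K: "compact K"
  have "{z \<in> space (Cmeas s \<Otimes>\<^sub>M Cmeas t). oplus s z \<inter> K = {}} =
      {Z \<in> Cspace s. Z \<inter> K = {}} \<times> {Z \<in> Cspace t. Z \<inter> time_affine 1 (- s) ` K = {}}"
    using time_affine_image_disjoint[of 1 s _ K]
    by (auto simp: space_pair_measure oplus_def shift_eq Int_Un_distrib2)
  also have "\<dots> \<in> sets (Cmeas s \<Otimes>\<^sub>M Cmeas t)"
    using K by (intro pair_measureI miss_compact_sets compact_time_affine_image)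
  finally show "{z \<in> space (Cmeas s \<Otimes>\<^sub>M Cmeas t). oplus s z \<inter> K = {}} \<in>
    sets (Cmeas s \<Otimes>\<^sub>M Cmeas t)" .
qed (use assms in \<open>auto simp: space_pair_measure intro: oplus_in_Cspace\<close>)

lemma measurable_left_piece:
  assumes lc: "locally_compact_space (euclidean :: 'l::{t2_space, second_countable_topology} topology)"
  shows "left_piece s \<in> measurable (Cmeas u :: (real \<times> 'l) set measure) (Cmeas s)"
proof (rule measurable_into_Cmeas[OF lc])
  fix K :: "(real \<times> 'l) set" assume K: "compact K"
  have "{Z \<in> Cspace u. left_piece s Z \<inter> K = {}} = {Z \<in> Cspace u. Z \<inter> (K \<inter> ({0..s} \<times> UNIV)) = {}}"
    by (auto simp: left_piece_def)
  also have "\<dots> \<in> sets (Cmeas u)"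
    using K by (intro miss_compact_sets compact_Int_closed closed_Times) auto
  finally show "{Z \<in> space (Cmeas u). left_piece s Z \<inter> K = {}} \<in> sets (Cmeas u)"
    by simp
qed (auto simp: Cspace_def left_piece_def intro!: closed_Int closed_Times)

lemma measurable_right_piece:
  assumes lc: "locally_compact_space (euclidean :: 'l::{t2_space, second_countable_topology} topology)"
  shows "right_piece s t \<in> measurable (Cmeas u :: (real \<times> 'l) set measure) (Cmeas t)"
proof (rule measurable_into_Cmeas[OF lc])
  fix K :: "(real \<times> 'l) set" assume K: "compact K"
  have "{Z \<in> Cspace u. right_piece s t Z \<inter> K = {}} =
      {Z \<in> Cspace u. Z \<inter> (time_affine 1 s ` K \<inter> ({s..s+t} \<times> UNIV)) = {}}"
    using time_affine_image_disjoint[of 1 "- s" _ K]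
    by (auto simp: right_piece_eq Int_assoc Int_commute)
  also have "\<dots> \<in> sets (Cmeas u)"
    using K by (intro miss_compact_sets compact_Int_closed closed_Times compact_time_affine_image) auto
  finally show "{Z \<in> space (Cmeas u). right_piece s t Z \<inter> K = {}} \<in> sets (Cmeas u)"
    by simp
next
  fix Z :: "(real \<times> 'l) set" assume "Z \<in> space (Cmeas u)"
  then have "closed (right_piece s t Z)"
    unfolding right_piece_eq
    by (intro closed_time_affine_image closed_Int closed_Times) (auto simp: Cspace_def)
  then show "right_piece s t Z \<in> Cspace t"
    by (auto simp: Cspace_def right_piece_def)
qed

lemma measurable_rescale:
  assumes lc: "locally_compact_space (euclidean :: 'l::{t2_space, second_countable_topology} topology)"
    and "t > 0"
  shows "rescale t \<in> measurable (Cmeas (c * t) :: (real \<times> 'l) set measure) (Cmeas c)"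
proof (rule measurable_into_Cmeas[OF lc])
  fix K :: "(real \<times> 'l) set" assume K: "compact K"
  have "{Z \<in> Cspace (c * t). rescale t Z \<inter> K = {}} =
      {Z \<in> Cspace (c * t). Z \<inter> time_affine t 0 ` K = {}}"
    using time_affine_image_disjoint[of "1 / t" 0 _ K] \<open>t > 0\<close>
    by (auto simp: rescale_eq)
  also have "\<dots> \<in> sets (Cmeas (c * t))"
    using K by (intro miss_compact_sets compact_time_affine_image)
  finally show "{Z \<in> space (Cmeas (c * t)). rescale t Z \<inter> K = {}} \<in> sets (Cmeas (c * t))"
    by simp
qed (use assms in \<open>auto intro: rescale_in_Cspace\<close>)

text \<open>The left strip is closed, so a point of \<open>Z2\<close> at time \<open>0\<close>,
  moved to time \<open>s\<close>, would be kept; excluding such points makes restriction undo the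
  union. For the right piece it is the points of \<open>Z1\<close> at time \<open>s\<close> that
  have to be excluded.\<close>

lemma left_piece_oplus:
  assumes "Z1 \<in> Cspace s" "Z2 \<in> Cspace t" "Z2 \<inter> ({0} \<times> UNIV) = {}"
  shows "left_piece s (oplus s (Z1, Z2)) = Z1"
proof -
  have "0 < fst p" if "p \<in> Z2" for p
    using assms(2,3) that by (cases p) (auto simp: Cspace_def less_le)
  then have "shift s Z2 \<inter> ({0..s} \<times> UNIV) = {}"
    by (fastforce simp: shift_def)
  moreover have "Z1 \<inter> ({0..s} \<times> UNIV) = Z1"
    using assms(1) by (auto simp: Cspace_def)
  ultimately show ?thesis
    by (simp add: left_piece_def oplus_def Int_Un_distrib2)
qed

lemma right_piece_oplus:
  assumes "Z1 \<in> Cspace s" "Z2 \<in> Cspace t" "Z1 \<inter> ({s} \<times> UNIV) = {}"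
  shows "right_piece s t (oplus s (Z1, Z2)) = Z2"
proof -
  have "fst p < s" if "p \<in> Z1" for p
    using assms(1,3) that by (cases p) (auto simp: Cspace_def less_le)
  then have "Z1 \<inter> ({s..s+t} \<times> UNIV) = {}"
    by force
  moreover have "shift s Z2 \<inter> ({s..s+t} \<times> UNIV) = shift s Z2"
    using assms(2) by (auto simp: Cspace_def shift_def)
  ultimately have "oplus s (Z1, Z2) \<inter> ({s..s+t} \<times> UNIV) = shift s Z2"
    by (simp add: oplus_def Int_Un_distrib2)
  then show ?thesis
    by (simp add: right_piece_def shift_def image_image split_def)
qed

section \<open>Measurable fields of measures\<close>

text \<open>The approximable sets form a sigma-field: complementation does not change symmetric
  differences, and by continuity from below a countable union is, up to a small tail, a finite
  one.\<close>

lemma (in finite_measure) generating_algebra_approx: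
  assumes alg: "algebra (space M) \<A>" and gen: "sets M = sigma_sets (space M) \<A>"
    and B: "B \<in> sets M" and e: "(e::real) > 0"
  shows "\<exists>A\<in>\<A>. measure M (sym_diff A B) < e"
proof -
  interpret algebra "space M" \<A> by (rule alg)
  have sub: "A \<in> sets M" if "A \<in> \<A>" for A
    using that gen by auto
  from B[unfolded gen] e show ?thesis
  proof (induction arbitrary: e)
    case (Basic A)
    then show ?case by (intro bexI[of _ A]) auto
  next
    case Empty
    then show ?case by (intro bexI[of _ "{}"]) auto
  next
    case (Compl B)
    then obtain A where A: "A \<in> \<A>" "measure M (sym_diff A B) < e" by blast
    have "B \<subseteq> space M"
      using Compl.hyps gen sets.sets_into_space by blast
    then have "sym_diff (space M - A) (space M - B) = sym_diff A B"
      using sets.sets_into_space[OF sub[OF A(1)]] by blast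
    then show ?case
      using A by (intro bexI[of _ "space M - A"]) auto
  next
    case (Union B)
    have B: "B i \<in> sets M" for i
      using Union.hyps gen by auto
    have "(\<lambda>n. measure M (\<Union>i<n. B i)) \<longlonglongrightarrow> measure M (\<Union>n. \<Union>i<n. B i)"
      by (rule finite_Lim_measure_incseq) (use B in \<open>force simp: incseq_def\<close>)+
    moreover have "(\<Union>n. \<Union>i<n. B i) = (\<Union>i. B i)"
      by auto
    ultimately have "(\<lambda>n. measure M (\<Union>i<n. B i)) \<longlonglongrightarrow> measure M (\<Union>i. B i)"
      by simp
    then have "\<forall>\<^sub>F n in sequentially. dist (measure M (\<Union>i<n. B i)) (measure M (\<Union>i. B i)) < e / 2"
      using Union.prems by (intro tendstoD) auto
    then obtain n where n: "dist (measure M (\<Union>i<n. B i)) (measure M (\<Union>i. B i)) < e / 2"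
      unfolding eventually_sequentially by blast
    have tail: "measure M ((\<Union>i. B i) - (\<Union>i<n. B i)) < e / 2"
    proof (subst finite_measure_Diff)
      show "measure M (\<Union>i. B i) - measure M (\<Union>i<n. B i) < e / 2"
        using n abs_ge_minus_self[of "measure M (\<Union>i<n. B i) - measure M (\<Union>i. B i)"]
        unfolding dist_real_def by linarith
    qed (use B in auto)
    \<comment> \<open>The \<open>n\<close> errors together may use \<open>e / 2\<close>, the other
      half being spent on the tail; \<open>n + 1\<close> instead of \<open>n\<close> avoids a zero
      denominator.\<close>
    have "\<forall>i. \<exists>A\<in>\<A>. measure M (sym_diff A (B i)) < e / (2 * (real n + 1))"
      using Union.IH Union.prems by simp
    then obtain A where A: "\<And>i. A i \<in> \<A>"
        "\<And>i. measure M (sym_diff (A i) (B i)) < e / (2 * (real n + 1))"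
      by metis
    have ms: "sym_diff (A i) (B i) \<in> sets M" for i
      using A sub B by auto
    have "measure M (sym_diff (\<Union>i<n. A i) (\<Union>i. B i)) \<le>
        measure M ((\<Union>i<n. sym_diff (A i) (B i)) \<union> ((\<Union>i. B i) - (\<Union>i<n. B i)))"
      by (rule finite_measure_mono) (use B ms in \<open>auto intro!: sets.Un sets.finite_UN\<close>)
    also have "\<dots> \<le> measure M (\<Union>i<n. sym_diff (A i) (B i)) + measure M ((\<Union>i. B i) - (\<Union>i<n. B i))"
      using ms B by (intro measure_Un_le) auto
    also have "measure M (\<Union>i<n. sym_diff (A i) (B i)) \<le> (\<Sum>i<n. measure M (sym_diff (A i) (B i)))"
      using ms by (intro measure_UNION_le) auto
    also have "\<dots> \<le> (\<Sum>i<n. e / (2 * (real n + 1)))"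
      using A(2) by (intro sum_mono) (simp add: less_imp_le)
    also have "\<dots> = e / 2 * (real n / (real n + 1))"
      by simp
    also have "\<dots> \<le> e / 2"
      using Union.prems by (intro mult_right_le_one_le) auto
    finally have "measure M (sym_diff (\<Union>i<n. A i) (\<Union>i. B i)) < e"
      using tail by simp
    then show ?case
      using A by (intro bexI[of _ "\<Union>i<n. A i"]) auto
  qed
qed

text \<open>Encoded as formal lists, with overlapping sets allowed, so that a countable algebra
  yields countably many functions and a sum is a concatenation. No measure enters, so the same list
  serves all parameters.\<close>

definition rat_simple :: "(rat \<times> 'a set) list \<Rightarrow> 'a \<Rightarrow> real" where
  "rat_simple xs x = (\<Sum>(q, A)\<leftarrow>xs. of_rat q * indicator A x)"

lemma rat_simple_Nil [simp]: "rat_simple [] x = 0"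
  and rat_simple_Cons [simp]: "rat_simple ((q, A) # xs) x = of_rat q * indicator A x + rat_simple xs x"
  and rat_simple_append [simp]: "rat_simple (xs @ ys) x = rat_simple xs x + rat_simple ys x"
  by (simp_all add: rat_simple_def)

lemma borel_measurable_rat_simple:
  "xs \<in> lists (UNIV \<times> sets M) \<Longrightarrow> rat_simple xs \<in> borel_measurable M"
proof (induction xs)
  case Nil
  then show ?case by (simp cong: measurable_cong)
next
  case (Cons p xs)
  obtain q A where p: "p = (q, A)" by (cases p)
  then have [measurable]: "A \<in> sets M" "rat_simple xs \<in> borel_measurable M"
    using Cons by auto
  have "(\<lambda>x. of_rat q * indicator A x + rat_simple xs x) \<in> borel_measurable M"
    by measurable
  then show ?case
    by (simp add: p cong: measurable_cong)
qed

lemma bounded_rat_simple: "\<exists>C. \<forall>x. \<bar>rat_simple xs x\<bar> \<le> C"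
proof (induction xs)
  case (Cons p xs)
  then obtain C where C: "\<And>x. \<bar>rat_simple xs x\<bar> \<le> C" by blast
  obtain q A where p: "p = (q, A)" by (cases p)
  have "\<bar>rat_simple (p # xs) x\<bar> \<le> \<bar>of_rat q\<bar> + C" for x
  proof -
    have "\<bar>of_rat q * indicator A x :: real\<bar> \<le> \<bar>of_rat q\<bar>"
      by (auto simp: indicator_def)
    then show ?thesis
      using C[of x] by (simp add: p)
  qed
  then show ?case by blast
qed auto

lemma add_square_le_double: "(a + b)\<^sup>2 \<le> 2 * a\<^sup>2 + 2 * b\<^sup>2" for a b :: real
  using zero_le_power2[of "a - b"] by (simp add: power2_eq_square algebra_simps)

text \<open>Approximability (\<open>apx\<close>) passes to sums, so multiples of indicators give
  simple functions, and dominated convergence gives all of L^2.\<close>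

lemma (in finite_measure) rat_simple_dense_L2:
  fixes f :: "'a \<Rightarrow> real"
  assumes alg: "algebra (space M) \<A>" and gen: "sets M = sigma_sets (space M) \<A>"
    and f: "f \<in> borel_measurable M" "integrable M (\<lambda>x. (f x)\<^sup>2)" and e: "(e::real) > 0"
  shows "\<exists>xs\<in>lists (UNIV \<times> \<A>). (\<integral>\<^sup>+x. ennreal ((f x - rat_simple xs x)\<^sup>2) \<partial>M) < ennreal e"
proof -
  interpret algebra "space M" \<A> by (rule alg)
  have sub: "\<A> \<subseteq> sets M"
    using gen by auto
  define apx where "apx g \<longleftrightarrow> (\<forall>e>0. \<exists>xs\<in>lists (UNIV \<times> \<A>).
      (\<integral>\<^sup>+x. ennreal ((g x - rat_simple xs x)\<^sup>2) \<partial>M) < ennreal e)" for g :: "'a \<Rightarrow> real"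
  have rs: "rat_simple xs \<in> borel_measurable M" if "xs \<in> lists (UNIV \<times> \<A>)" for xs
    using that sub by (intro borel_measurable_rat_simple) auto
  \<comment> \<open>Substitute for the triangle inequality on squared distances: in
    \<open>(g + h)^2 \<le> 2 g^2 + 2 h^2\<close> two errors of \<open>e / 4\<close>, each doubled,
    add up to \<open>e\<close>.\<close>
  have split_le: "(\<integral>\<^sup>+x. ennreal ((g x + h x)\<^sup>2) \<partial>M) < ennreal e"
    if gh: "g \<in> borel_measurable M" "h \<in> borel_measurable M" "(\<integral>\<^sup>+x. ennreal ((g x)\<^sup>2) \<partial>M) < ennreal (e / 4)"
      "(\<integral>\<^sup>+x. ennreal ((h x)\<^sup>2) \<partial>M) < ennreal (e / 4)" "e > 0" for g h :: "'a \<Rightarrow> real" and e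
  proof -
    have "(\<integral>\<^sup>+x. ennreal ((g x + h x)\<^sup>2) \<partial>M) \<le> (\<integral>\<^sup>+x. 2 * ennreal ((g x)\<^sup>2) + 2 * ennreal ((h x)\<^sup>2) \<partial>M)"
    proof (rule nn_integral_mono)
      fix x
      have "ennreal ((g x + h x)\<^sup>2) \<le> ennreal (2 * (g x)\<^sup>2 + 2 * (h x)\<^sup>2)"
        by (intro ennreal_leI add_square_le_double)
      then show "ennreal ((g x + h x)\<^sup>2) \<le> 2 * ennreal ((g x)\<^sup>2) + 2 * ennreal ((h x)\<^sup>2)"
        by (simp add: ennreal_mult ennreal_plus)
    qed
    also have "\<dots> = 2 * (\<integral>\<^sup>+x. ennreal ((g x)\<^sup>2) \<partial>M) + 2 * (\<integral>\<^sup>+x. ennreal ((h x)\<^sup>2) \<partial>M)"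
      using gh by (simp add: nn_integral_add nn_integral_cmult)
    also have "\<dots> < 2 * ennreal (e / 4) + 2 * ennreal (e / 4)"
      using gh by (intro add_strict_mono ennreal_mult_strict_left_mono) auto
    also have "\<dots> = ennreal e"
    proof -
      have "2 * ennreal (e / 4) = ennreal (e / 2)"
        using \<open>e > 0\<close> ennreal_mult[of 2 "e / 4"] by simp
      then show ?thesis
        using \<open>e > 0\<close> ennreal_plus[of "e / 2" "e / 2"] by simp
    qed
    finally show ?thesis .
  qed
  have add: "apx (\<lambda>x. g x + h x)"
    if gh: "g \<in> borel_measurable M" "h \<in> borel_measurable M" "apx g" "apx h" for g h
    unfolding apx_def
  proof (intro allI impI)
    fix e :: real assume e: "e > 0"
    obtain xs where xs: "xs \<in> lists (UNIV \<times> \<A>)"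
        "(\<integral>\<^sup>+x. ennreal ((g x - rat_simple xs x)\<^sup>2) \<partial>M) < ennreal (e / 4)"
      using gh(3) e unfolding apx_def by (metis divide_pos_pos zero_less_numeral)
    obtain ys where ys: "ys \<in> lists (UNIV \<times> \<A>)"
        "(\<integral>\<^sup>+x. ennreal ((h x - rat_simple ys x)\<^sup>2) \<partial>M) < ennreal (e / 4)"
      using gh(4) e unfolding apx_def by (metis divide_pos_pos zero_less_numeral)
    have "(\<integral>\<^sup>+x. ennreal (((g x - rat_simple xs x) + (h x - rat_simple ys x))\<^sup>2) \<partial>M) < ennreal e"
      using xs ys e gh rs by (intro split_le) auto
    moreover have "(g x - rat_simple xs x) + (h x - rat_simple ys x) =
        g x + h x - rat_simple (xs @ ys) x" for x
      by simp
    ultimately have "(\<integral>\<^sup>+x. ennreal ((g x + h x - rat_simple (xs @ ys) x)\<^sup>2) \<partial>M) < ennreal e"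
      by simp
    then show "\<exists>xs\<in>lists (UNIV \<times> \<A>).
        (\<integral>\<^sup>+x. ennreal ((g x + h x - rat_simple xs x)\<^sup>2) \<partial>M) < ennreal e"
      using xs ys by (intro bexI[of _ "xs @ ys"]) auto
  qed
  have ind: "apx (\<lambda>x. y * indicator B x)" if B: "B \<in> sets M" for y B
    unfolding apx_def
  proof (intro allI impI)
    fix e :: real assume e: "e > 0"
    \<comment> \<open>The error is split as
      \<open>y 1_B - q 1_A = (y - q) 1_B + q (1_B - 1_A)\<close>: \<open>d\<close> controls the
      rational rounding and \<open>c\<close> the replacement of \<open>B\<close> by
      \<open>A\<close>, each up to \<open>e / 4\<close>. The added \<open>1\<close> keeps
      \<open>C\<close> and \<open>c\<close> positive, so that one can divide by them.\<close>
    define C where "C = measure M (space M) + 1"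
    have C: "C > 0" by (simp add: C_def add_nonneg_pos)
    define d where "d = sqrt (e / (4 * C))"
    have d: "d > 0" using e C by (simp add: d_def)
    then obtain q :: rat where q: "y - d < of_rat q" "of_rat q < y"
      using of_rat_dense[of "y - d" y] by auto
    have "(y - of_rat q)\<^sup>2 \<le> d\<^sup>2"
      using q by (intro power_mono) auto
    then have q2: "(y - of_rat q)\<^sup>2 * measure M B < e / 4"
    proof -
      have "(y - of_rat q)\<^sup>2 * measure M B \<le> d\<^sup>2 * measure M (space M)"
        using \<open>(y - of_rat q)\<^sup>2 \<le> d\<^sup>2\<close> by (intro mult_mono bounded_measure) auto
      also have "\<dots> < d\<^sup>2 * C"
        using d by (intro mult_strict_left_mono) (auto simp: C_def)
      also have "\<dots> = e / 4"
        using e C by (simp add: d_def)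
      finally show ?thesis .
    qed
    define c :: real where "c = (of_rat q)\<^sup>2 + 1"
    have c: "c > 0" by (simp add: c_def add_nonneg_pos)
    obtain A where A: "A \<in> \<A>" "measure M (sym_diff A B) < e / (4 * c)"
      using generating_algebra_approx[OF alg gen B, of "e / (4 * c)"] e c by auto
    have [measurable]: "A \<in> sets M" "B \<in> sets M"
      using A sub B by auto
    have "(\<integral>\<^sup>+x. ennreal (((y - of_rat q) * indicator B x)\<^sup>2) \<partial>M) =
        (\<integral>\<^sup>+x. ennreal ((y - of_rat q)\<^sup>2) * indicator B x \<partial>M)"
      by (intro nn_integral_cong) (auto simp: indicator_def)
    also have "\<dots> = ennreal ((y - of_rat q)\<^sup>2 * measure M B)"
      using B by (simp add: nn_integral_cmult emeasure_eq_measure ennreal_mult)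
    also have "\<dots> < ennreal (e / 4)"
      using q2 e by (intro ennreal_lessI) auto
    finally have 1: "(\<integral>\<^sup>+x. ennreal (((y - of_rat q) * indicator B x)\<^sup>2) \<partial>M) < ennreal (e / 4)" .
    have "(\<integral>\<^sup>+x. ennreal ((of_rat q * (indicator B x - indicator A x))\<^sup>2) \<partial>M) =
        (\<integral>\<^sup>+x. ennreal ((of_rat q)\<^sup>2) * indicator (sym_diff A B) x \<partial>M)"
      by (intro nn_integral_cong) (auto simp: indicator_def)
    also have "\<dots> = ennreal ((of_rat q)\<^sup>2 * measure M (sym_diff A B))"
      by (simp add: nn_integral_cmult emeasure_eq_measure ennreal_mult)
    also have "\<dots> < ennreal (e / 4)"
    proof (rule ennreal_lessI)
      have "(of_rat q)\<^sup>2 * measure M (sym_diff A B) \<le> c * measure M (sym_diff A B)"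
        by (intro mult_right_mono) (auto simp: c_def)
      also have "\<dots> < c * (e / (4 * c))"
        using A c by (intro mult_strict_left_mono) auto
      finally show "(of_rat q)\<^sup>2 * measure M (sym_diff A B) < e / 4"
        using c by simp
    qed (use e in auto)
    finally have 2: "(\<integral>\<^sup>+x. ennreal ((of_rat q * (indicator B x - indicator A x))\<^sup>2) \<partial>M) < ennreal (e / 4)" .
    have "(\<integral>\<^sup>+x. ennreal (((y - of_rat q) * indicator B x +
        of_rat q * (indicator B x - indicator A x))\<^sup>2) \<partial>M) < ennreal e"
      using 1 2 e by (intro split_le) auto
    moreover have "(y - of_rat q) * indicator B x + of_rat q * (indicator B x - indicator A x) =
        y * indicator B x - rat_simple [(q, A)] x" for x
      by (simp add: algebra_simps)
    ultimately have "(\<integral>\<^sup>+x. ennreal ((y * indicator B x - rat_simple [(q, A)] x)\<^sup>2) \<partial>M) < ennreal e"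
      by simp
    then show "\<exists>xs\<in>lists (UNIV \<times> \<A>).
        (\<integral>\<^sup>+x. ennreal ((y * indicator B x - rat_simple xs x)\<^sup>2) \<partial>M) < ennreal e"
      using A by (intro bexI[of _ "[(q, A)]"]) auto
  qed
  have simple: "apx g" if g: "simple_function M g" for g :: "'a \<Rightarrow> real"
  proof -
    have level: "g -` {y} \<inter> space M \<in> sets M" for y
      using g by (rule simple_functionD)
    have sum: "apx (\<lambda>x. \<Sum>y\<in>Y. y * indicator (g -` {y} \<inter> space M) x)" if "finite Y" for Y
      using that
    proof induction
      case empty
      show ?case
        unfolding apx_def by (auto intro!: bexI[of _ "[]"])
    next
      case (insert y Y)
      have "apx (\<lambda>x. y * indicator (g -` {y} \<inter> space M) x +
          (\<Sum>y\<in>Y. y * indicator (g -` {y} \<inter> space M) x))"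
        using insert.IH level by (intro add ind) auto
      then show ?case
        unfolding sum.insert[OF insert.hyps] .
    qed
    have "(\<integral>\<^sup>+x. ennreal ((g x - r x)\<^sup>2) \<partial>M) =
      (\<integral>\<^sup>+x. ennreal (((\<Sum>y\<in>g ` space M. y * indicator (g -` {y} \<inter> space M) x) - r x)\<^sup>2) \<partial>M)"
      for r :: "'a \<Rightarrow> real"
    proof (intro nn_integral_cong)
      fix x assume x: "x \<in> space M"
      have "(\<Sum>y\<in>g ` space M. y * indicator (g -` {y} \<inter> space M) x) =
          (\<Sum>y\<in>g ` space M. if y = g x then g x else 0)"
        using x by (intro sum.cong) (auto simp: indicator_def)
      also have "\<dots> = g x"
        using x simple_functionD(1)[OF g] by simp
      finally show "ennreal ((g x - r x)\<^sup>2) =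
        ennreal (((\<Sum>y\<in>g ` space M. y * indicator (g -` {y} \<inter> space M) x) - r x)\<^sup>2)" by simp
    qed
    then show ?thesis
      using sum[OF simple_functionD(1)[OF g]] unfolding apx_def by simp
  qed
  obtain S where S: "\<And>i. simple_function M (S i)" "\<And>x. x \<in> space M \<Longrightarrow> (\<lambda>i. S i x) \<longlonglongrightarrow> f x"
      "\<And>i x. x \<in> space M \<Longrightarrow> dist (S i x) 0 \<le> 2 * dist (f x) 0"
    using borel_measurable_implies_sequence_metric[OF f(1), of 0] by blast
  have Sm [measurable]: "S i \<in> borel_measurable M" for i
    using S(1) by (rule borel_measurable_simple_function)
  note [measurable] = f(1)
  have "(\<lambda>i. \<integral>\<^sup>+x. ennreal ((f x - S i x)\<^sup>2) \<partial>M) \<longlonglongrightarrow> (\<integral>\<^sup>+x. 0 \<partial>M)"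
  \<comment> \<open>From \<open>|S i| \<le> 2 |f|\<close> follows
    \<open>|f - S i| \<le> 3 |f|\<close>, hence the factor 9 in the majorant.\<close>
  proof (rule nn_integral_dominated_convergence[where w = "\<lambda>x. ennreal (9 * (f x)\<^sup>2)"])
    show "AE x in M. ennreal ((f x - S i x)\<^sup>2) \<le> ennreal (9 * (f x)\<^sup>2)" for i
    proof (intro AE_I2 ennreal_leI)
      fix x assume "x \<in> space M"
      then have "\<bar>f x - S i x\<bar> \<le> \<bar>3 * f x\<bar>"
        using S(3)[of x i] by (simp add: dist_real_def)
      then have "\<bar>f x - S i x\<bar>\<^sup>2 \<le> \<bar>3 * f x\<bar>\<^sup>2"
        by (rule power_mono) simp
      then show "(f x - S i x)\<^sup>2 \<le> 9 * (f x)\<^sup>2"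
        by (simp add: power_mult_distrib)
    qed
    show "(\<integral>\<^sup>+x. ennreal (9 * (f x)\<^sup>2) \<partial>M) < \<infinity>"
      using f(2) integrableD(2)[of M "\<lambda>x. 9 * (f x)\<^sup>2"]
      by (simp add: top.not_eq_extremum nn_integral_eq_integral)
    show "AE x in M. (\<lambda>i. ennreal ((f x - S i x)\<^sup>2)) \<longlonglongrightarrow> 0"
    proof (rule AE_I2)
      fix x assume "x \<in> space M"
      then have "(\<lambda>i. ennreal ((f x - S i x)\<^sup>2)) \<longlonglongrightarrow> ennreal ((f x - f x)\<^sup>2)"
        by (intro tendsto_intros S(2))
      then show "(\<lambda>i. ennreal ((f x - S i x)\<^sup>2)) \<longlonglongrightarrow> 0" by simp
    qed
  qed simp_all
  then have "\<forall>\<^sub>F i in sequentially. (\<integral>\<^sup>+x. ennreal ((f x - S i x)\<^sup>2) \<partial>M) < ennreal (e / 4)"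
    using e by (intro order_tendstoD) auto
  then obtain i where i: "(\<integral>\<^sup>+x. ennreal ((f x - S i x)\<^sup>2) \<partial>M) < ennreal (e / 4)"
    unfolding eventually_sequentially by blast
  obtain xs where xs: "xs \<in> lists (UNIV \<times> \<A>)"
      "(\<integral>\<^sup>+x. ennreal ((S i x - rat_simple xs x)\<^sup>2) \<partial>M) < ennreal (e / 4)"
    using simple[OF S(1)[of i]] e unfolding apx_def by (metis divide_pos_pos zero_less_numeral)
  have "(\<integral>\<^sup>+x. ennreal (((f x - S i x) + (S i x - rat_simple xs x))\<^sup>2) \<partial>M) < ennreal e"
    using i xs e rs by (intro split_le) auto
  then show ?thesis
    using xs by auto
qed

section \<open>Borel dependence of integrals on a parameter\<close>

text \<open>Dynkin's argument for the signed set functions with densities \<open>w t\<close>. The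
  integral over the whole space is a hypothesis of its own, because \<open>G\<close> need not
  contain \<open>space N\<close> and the complement step subtracts from that integral.\<close>

lemma borel_measurable_set_integral_generated:
  fixes w :: "'t \<Rightarrow> 'a \<Rightarrow> real"
  assumes G: "Int_stable G" "G \<subseteq> Pow (space N)" "sets N = sigma_sets (space N) G"
    and sets: "\<And>t. t \<in> space T \<Longrightarrow> sets (\<rho> t) = sets N"
    and int: "\<And>t. t \<in> space T \<Longrightarrow> integrable (\<rho> t) (w t)"
    and gen: "\<And>A. A \<in> G \<Longrightarrow> (\<lambda>t. LINT x:A|\<rho> t. w t x) \<in> borel_measurable T"
    and whole: "(\<lambda>t. LINT x|\<rho> t. w t x) \<in> borel_measurable T"
    and A: "A \<in> sets N"
  shows "(\<lambda>t. LINT x:A|\<rho> t. w t x) \<in> borel_measurable T"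
proof -
  have si: "set_integrable (\<rho> t) B (w t)" if "t \<in> space T" "B \<in> sets N" for t B
    using that int sets unfolding set_integrable_def by (intro integrable_mult_indicator) auto
  have sp: "space (\<rho> t) = space N" if "t \<in> space T" for t
    using sets[OF that] by (rule sets_eq_imp_space_eq)
  from G(1,2) A[unfolded G(3)] show ?thesis
  proof (induction rule: sigma_sets_induct_disjoint)
    case (basic A)
    then show ?case by (rule gen)
  next
    case empty
    then show ?case by (simp add: set_lebesgue_integral_def)
  next
    case (compl A)
    then have A: "A \<in> sets N" using G(3) by simp
    have "(LINT x:space N - A|\<rho> t. w t x) = (LINT x|\<rho> t. w t x) - (LINT x:A|\<rho> t. w t x)"
      if t: "t \<in> space T" for t
    proof -
      have "(LINT x:A \<union> (space N - A)|\<rho> t. w t x) =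
          (LINT x:A|\<rho> t. w t x) + (LINT x:space N - A|\<rho> t. w t x)"
        using A t by (intro set_integral_Un si) auto
      moreover have "A \<union> (space N - A) = space (\<rho> t)"
        using sets.sets_into_space[OF A] sp[OF t] by auto
      ultimately show ?thesis
        using int[OF t] by (simp add: set_integral_space)
    qed
    then show ?case
      using compl.IH whole by (simp cong: measurable_cong)
  next
    case (union A)
    have A: "A i \<in> sets N" for i
      using union G(3) by auto
    have "(LINT x:(\<Union>i. A i)|\<rho> t. w t x) = (\<Sum>i. (LINT x:A i|\<rho> t. w t x))" if t: "t \<in> space T" for t
      using A sets[OF t] union.hyps(1) si[OF t, of "\<Union>i. A i"]
      by (intro lebesgue_integral_countable_add) (auto simp: disjoint_family_on_def)
    then show ?case
      using union.IH by (simp cong: measurable_cong)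
  qed
qed

text \<open>The situation after rescaling: all measures live on one sigma-field. The generating
  algebra is countable and does not vary with \<open>t\<close>; this is the source of countable
  families of functions that are dense in every L^2 space of the field.\<close>

locale measure_field =
  fixes T :: "'t measure" and N :: "'a measure" and \<rho> :: "'t \<Rightarrow> 'a measure" and \<A> :: "'a set set"
  assumes fin: "\<And>t. t \<in> space T \<Longrightarrow> finite_measure (\<rho> t)"
    and sets_field: "\<And>t. t \<in> space T \<Longrightarrow> sets (\<rho> t) = sets N"
    and measurable_field: "\<And>A. A \<in> sets N \<Longrightarrow> (\<lambda>t. measure (\<rho> t) A) \<in> borel_measurable T"
    and alg: "algebra (space N) \<A>" and count: "countable \<A>"
    and gen: "sets N = sigma_sets (space N) \<A>"
begin

text \<open>A weak notion: each \<open>w t\<close> enters only through its integrals, hence only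
  modulo null sets, as befits elements of L^2. Integrability is assumed separately wherever an
  integral is split.\<close>

definition borel_section :: "('t \<Rightarrow> 'a \<Rightarrow> real) \<Rightarrow> bool" where
  "borel_section w \<longleftrightarrow> (\<forall>A\<in>sets N. (\<lambda>t. LINT x:A|\<rho> t. w t x) \<in> borel_measurable T)"

lemma borel_sectionD:
  "borel_section w \<Longrightarrow> A \<in> sets N \<Longrightarrow> (\<lambda>t. LINT x:A|\<rho> t. w t x) \<in> borel_measurable T"
  by (simp add: borel_section_def)

lemma space_field: "t \<in> space T \<Longrightarrow> space (\<rho> t) = space N"
  using sets_field by (rule sets_eq_imp_space_eq)

lemma measurable_sets_field: "t \<in> space T \<Longrightarrow> f \<in> borel_measurable (\<rho> t) \<longleftrightarrow> f \<in> borel_measurable N"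
  by (rule arg_cong[where f = "\<lambda>S. f \<in> S"]) (intro measurable_cong_sets sets_field refl)

lemma borel_section_const: "borel_section (\<lambda>t x. c)"
  unfolding borel_section_def
proof
  fix A assume A: "A \<in> sets N"
  have "(LINT x:A|\<rho> t. c) = measure (\<rho> t) A * c" if "t \<in> space T" for t
    using A that by (simp add: set_lebesgue_integral_def sets_field space_field Int_absorb2
        sets.sets_into_space)
  then show "(\<lambda>t. LINT x:A|\<rho> t. c) \<in> borel_measurable T"
    using measurable_field[OF A] by (simp cong: measurable_cong)
qed

lemma set_integrable_field:
  "t \<in> space T \<Longrightarrow> A \<in> sets N \<Longrightarrow> integrable (\<rho> t) w \<Longrightarrow> set_integrable (\<rho> t) A w"
  for w :: "'a \<Rightarrow> real"
  unfolding set_integrable_def by (intro integrable_mult_indicator) (auto simp: sets_field)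

lemma integrable_mult_rat_simple:
  assumes "t \<in> space T" "integrable (\<rho> t) w" "xs \<in> lists (UNIV \<times> sets N)"
  shows "integrable (\<rho> t) (\<lambda>x. w x * rat_simple xs x)"
proof -
  obtain C where C: "\<And>x. \<bar>rat_simple xs x\<bar> \<le> C"
    using bounded_rat_simple by blast
  show ?thesis
  proof (rule Bochner_Integration.integrable_bound)
    show "integrable (\<rho> t) (\<lambda>x. C * w x)"
      using assms by simp
    show "(\<lambda>x. w x * rat_simple xs x) \<in> borel_measurable (\<rho> t)"
      using assms by (intro borel_measurable_times borel_measurable_rat_simple) (auto simp: sets_field)
    show "AE x in \<rho> t. norm (w x * rat_simple xs x) \<le> norm (C * w x)"
    proof (rule AE_I2)
      fix x
      have "\<bar>rat_simple xs x\<bar> * \<bar>w x\<bar> \<le> \<bar>C\<bar> * \<bar>w x\<bar>"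
        using C[of x] by (intro mult_right_mono) auto
      then show "norm (w x * rat_simple xs x) \<le> norm (C * w x)"
        by (simp add: abs_mult mult.commute)
    qed
  qed
qed

lemma borel_section_mult_rat_simple:
  assumes w: "borel_section w" "\<And>t. t \<in> space T \<Longrightarrow> integrable (\<rho> t) (w t)"
    and xs: "xs \<in> lists (UNIV \<times> sets N)"
  shows "borel_section (\<lambda>t x. w t x * rat_simple xs x)"
  using xs
proof (induction xs)
  case Nil
  then show ?case using borel_section_const[of 0] by simp
next
  case (Cons p xs)
  obtain q B where p: "p = (q, B)" by (cases p)
  have B: "B \<in> sets N" and xs: "xs \<in> lists (UNIV \<times> sets N)"
    using Cons p by auto
  show ?case
    unfolding borel_section_def
  proof
    fix A assume A: "A \<in> sets N"
    have "(LINT x:A|\<rho> t. w t x * rat_simple (p # xs) x) =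
        of_rat q * (LINT x:A \<inter> B|\<rho> t. w t x) + (LINT x:A|\<rho> t. w t x * rat_simple xs x)"
      if t: "t \<in> space T" for t
    proof -
      have AB: "set_integrable (\<rho> t) (A \<inter> B) (w t)"
        using A B t w by (intro set_integrable_field) auto
      have A2: "set_integrable (\<rho> t) A (\<lambda>x. w t x * rat_simple xs x)"
        using A t w xs by (intro set_integrable_field integrable_mult_rat_simple) auto
      have "(LINT x:A|\<rho> t. w t x * rat_simple (p # xs) x) =
        (LINT x|\<rho> t. of_rat q * (indicator (A \<inter> B) x * w t x) +
          indicator A x * (w t x * rat_simple xs x))"
        unfolding set_lebesgue_integral_def
        by (intro Bochner_Integration.integral_cong) (auto simp: p indicator_def algebra_simps)
      also have "\<dots> = of_rat q * (LINT x:A \<inter> B|\<rho> t. w t x) + (LINT x:A|\<rho> t. w t x * rat_simple xs x)"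
        using AB A2 unfolding set_lebesgue_integral_def set_integrable_def by simp
      finally show ?thesis .
    qed
    moreover have "(\<lambda>t. LINT x:A \<inter> B|\<rho> t. w t x) \<in> borel_measurable T"
      "(\<lambda>t. LINT x:A|\<rho> t. w t x * rat_simple xs x) \<in> borel_measurable T"
      using A B w(1) Cons.IH xs unfolding borel_section_def by auto
    ultimately show "(\<lambda>t. LINT x:A|\<rho> t. w t x * rat_simple (p # xs) x) \<in> borel_measurable T"
      by (simp cong: measurable_cong)
  qed
qed

text \<open>\<open>\<integral> w\<^sup>2 = sup (2 \<integral> c w - \<integral> c\<^sup>2)\<close> over a countable dense set of functions \<open>c\<close>
  which do not depend on the parameter \<open>t\<close>.\<close>

lemma borel_section_square:
  assumes w: "borel_section w" "\<And>t. t \<in> space T \<Longrightarrow> w t \<in> borel_measurable N"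
      "\<And>t. t \<in> space T \<Longrightarrow> integrable (\<rho> t) (\<lambda>x. (w t x)\<^sup>2)"
  shows "borel_section (\<lambda>t x. (w t x)\<^sup>2)"
  unfolding borel_section_def
proof
  fix A assume A: "A \<in> sets N"
  let ?L = "lists (UNIV \<times> \<A>) :: (rat \<times> 'a set) list set"
  define F where "F xs t = 2 * (LINT x:A|\<rho> t. w t x * rat_simple xs x)
      - (LINT x:A|\<rho> t. rat_simple xs x * rat_simple xs x)" for xs t
  have L: "countable ?L" "?L \<noteq> {}"
    using count by (auto intro!: countable_lists)
  have sub: "?L \<subseteq> lists (UNIV \<times> sets N)"
    using gen by auto
  have w1: "integrable (\<rho> t) (w t)" if t: "t \<in> space T" for t
    using finite_measure.square_integrable_imp_integrable[OF fin[OF t], of "w t"] w t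
    by (simp add: measurable_sets_field)
  have const1: "integrable (\<rho> t) (\<lambda>x. 1::real)" if t: "t \<in> space T" for t
    using finite_measure.integrable_const[OF fin[OF t]] .
  have r1: "integrable (\<rho> t) (rat_simple xs)" if "t \<in> space T" "xs \<in> ?L" for t xs
    using integrable_mult_rat_simple[OF that(1) const1[OF that(1)], of xs] that sub by auto
  have F_meas: "F xs \<in> borel_measurable T" if xs: "xs \<in> ?L" for xs
  proof -
    have xs': "xs \<in> lists (UNIV \<times> sets N)" using xs sub by blast
    have "borel_section (\<lambda>t. rat_simple xs)"
      using borel_section_mult_rat_simple[OF borel_section_const[of 1] const1 xs'] by simp
    then have "borel_section (\<lambda>t x. rat_simple xs x * rat_simple xs x)"
      using r1[OF _ xs] xs' by (rule borel_section_mult_rat_simple)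
    moreover have "borel_section (\<lambda>t x. w t x * rat_simple xs x)"
      using w(1) w1 xs' by (rule borel_section_mult_rat_simple)
    ultimately show ?thesis
      using A unfolding F_def
      by (intro borel_measurable_diff borel_measurable_times borel_measurable_const borel_sectionD)
  qed
  \<comment> \<open>Completing the square: \<open>F xs t\<close> falls short of the integral of
    \<open>w^2\<close> by the squared L^2 distance over \<open>A\<close> from \<open>w t\<close> to
    \<open>rat_simple xs\<close>. The gap is thus nonnegative and, by density, arbitrarily
    small.\<close>
  have F_eq: "(LINT x:A|\<rho> t. (w t x)\<^sup>2) - F xs t = (LINT x:A|\<rho> t. (w t x - rat_simple xs x)\<^sup>2)"
    and F_int: "integrable (\<rho> t) (\<lambda>x. (w t x - rat_simple xs x)\<^sup>2)"
    if t: "t \<in> space T" and xs: "xs \<in> ?L" for t xs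
  proof -
    have xs': "xs \<in> lists (UNIV \<times> sets N)" using xs sub by blast
    have 1: "integrable (\<rho> t) (\<lambda>x. w t x * rat_simple xs x)"
      using t w1 xs' by (intro integrable_mult_rat_simple) auto
    have 2: "integrable (\<rho> t) (\<lambda>x. rat_simple xs x * rat_simple xs x)"
      using t r1 xs xs' by (intro integrable_mult_rat_simple) auto
    have sq: "(w t x - rat_simple xs x)\<^sup>2 =
        (w t x)\<^sup>2 - 2 * (w t x * rat_simple xs x) + rat_simple xs x * rat_simple xs x" for x
      by (simp add: power2_eq_square algebra_simps)
    show "integrable (\<rho> t) (\<lambda>x. (w t x - rat_simple xs x)\<^sup>2)"
      unfolding sq using 1 2 w(3)[OF t] by simp
    have "(LINT x:A|\<rho> t. (w t x)\<^sup>2 - 2 * (w t x * rat_simple xs x) + rat_simple xs x * rat_simple xs x)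
      = (LINT x:A|\<rho> t. (w t x)\<^sup>2) - (LINT x:A|\<rho> t. 2 * (w t x * rat_simple xs x))
        + (LINT x:A|\<rho> t. rat_simple xs x * rat_simple xs x)"
      using 1 2 w(3)[OF t] t A
      by (subst set_integral_add set_integral_diff;
          (intro set_integrable_field Bochner_Integration.integrable_diff integrable_mult_right)?;
          simp?)+
    then show "(LINT x:A|\<rho> t. (w t x)\<^sup>2) - F xs t = (LINT x:A|\<rho> t. (w t x - rat_simple xs x)\<^sup>2)"
      unfolding sq F_def by simp
  qed
  have F_le: "F xs t \<le> (LINT x:A|\<rho> t. (w t x)\<^sup>2)" if "t \<in> space T" "xs \<in> ?L" for t xs
  proof -
    have "0 \<le> (LINT x:A|\<rho> t. (w t x - rat_simple xs x)\<^sup>2)"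
      unfolding set_lebesgue_integral_def by (intro integral_nonneg_AE) auto
    then show ?thesis using F_eq[OF that] by simp
  qed
  have bdd: "bdd_above ((\<lambda>xs. F xs t) ` ?L)" if "t \<in> space T" for t
    using F_le[OF that] by (intro bdd_aboveI2) auto
  have "(LINT x:A|\<rho> t. (w t x)\<^sup>2) = (SUP xs\<in>?L. F xs t)" if t: "t \<in> space T" for t
  proof (rule antisym)
    show "(SUP xs\<in>?L. F xs t) \<le> (LINT x:A|\<rho> t. (w t x)\<^sup>2)"
      using F_le[OF t] L by (intro cSUP_least) auto
    show "(LINT x:A|\<rho> t. (w t x)\<^sup>2) \<le> (SUP xs\<in>?L. F xs t)"
    proof (rule field_le_epsilon)
      fix e :: real assume e: "e > 0"
      have "\<exists>xs\<in>?L. (\<integral>\<^sup>+x. ennreal ((w t x - rat_simple xs x)\<^sup>2) \<partial>\<rho> t) < ennreal e"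
        using finite_measure.rat_simple_dense_L2[OF fin[OF t], of \<A> "w t" e]
          alg gen w t e by (simp add: sets_field space_field measurable_sets_field)
      then obtain xs where xs: "xs \<in> ?L"
          "(\<integral>\<^sup>+x. ennreal ((w t x - rat_simple xs x)\<^sup>2) \<partial>\<rho> t) < ennreal e" by blast
      have "ennreal (LINT x|\<rho> t. (w t x - rat_simple xs x)\<^sup>2) < ennreal e"
        using xs F_int[OF t xs(1)] by (simp add: nn_integral_eq_integral)
      then have "(LINT x|\<rho> t. (w t x - rat_simple xs x)\<^sup>2) < e"
        using e by (simp add: ennreal_less_iff)
      \<comment> \<open>Density is known over the whole space only; since the integrand is
        nonnegative, restricting to \<open>A\<close> makes the distance smaller.\<close>
      moreover have "(LINT x:A|\<rho> t. (w t x - rat_simple xs x)\<^sup>2) \<le> (LINT x|\<rho> t. (w t x - rat_simple xs x)\<^sup>2)"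
        unfolding set_lebesgue_integral_def
        using F_int[OF t xs(1)] set_integrable_field[OF t A F_int[OF t xs(1)]]
        by (intro integral_mono) (auto simp: set_integrable_def indicator_def)
      moreover have "F xs t \<le> (SUP xs\<in>?L. F xs t)"
        using xs bdd[OF t] by (intro cSUP_upper)
      ultimately show "(LINT x:A|\<rho> t. (w t x)\<^sup>2) \<le> (SUP xs\<in>?L. F xs t) + e"
        using F_eq[OF t xs(1)] by linarith
    qed
  qed
  moreover have "(\<lambda>t. SUP xs\<in>?L. F xs t) \<in> borel_measurable T"
    using L F_meas bdd by (intro borel_measurable_cSUP) auto
  ultimately show "(\<lambda>t. LINT x:A|\<rho> t. (w t x)\<^sup>2) \<in> borel_measurable T"
    by (simp cong: measurable_cong)
qed

lemma borel_section_add: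
  assumes "borel_section v" "borel_section w"
    "\<And>t. t \<in> space T \<Longrightarrow> integrable (\<rho> t) (v t)" "\<And>t. t \<in> space T \<Longrightarrow> integrable (\<rho> t) (w t)"
  shows "borel_section (\<lambda>t x. v t x + w t x)"
  unfolding borel_section_def
proof
  fix A assume A: "A \<in> sets N"
  have "(LINT x:A|\<rho> t. v t x + w t x) = (LINT x:A|\<rho> t. v t x) + (LINT x:A|\<rho> t. w t x)"
    if "t \<in> space T" for t
    using that A assms by (intro set_integral_add set_integrable_field) auto
  then show "(\<lambda>t. LINT x:A|\<rho> t. v t x + w t x) \<in> borel_measurable T"
    using borel_measurable_add[OF borel_sectionD[OF assms(1) A] borel_sectionD[OF assms(2) A]]
    by (simp cong: measurable_cong)
qed

lemma borel_section_cmult: "borel_section w \<Longrightarrow> borel_section (\<lambda>t x. c * w t x)"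
  unfolding borel_section_def set_integral_mult_right
  by (intro ballI borel_measurable_times borel_measurable_const) auto

text \<open>Products of sections are reached only through squares, and squares require
  integrability. The bounds on \<open>g\<close> give it once and for all: a continuous function of
  \<open>g\<close> is bounded and the measures are finite.\<close>

lemma borel_section_polynomial:
  assumes g: "borel_section g" "\<And>t. t \<in> space T \<Longrightarrow> g t \<in> borel_measurable N"
      "\<And>t x. 0 \<le> g t x" "\<And>t x. g t x \<le> 1"
    and p: "real_polynomial_function p"
  shows "borel_section (\<lambda>t x. p (g t x))"
proof -
  have comp: "k (g t x) \<in> k ` {0..1}" for k t x
    using g by auto
  have int: "integrable (\<rho> t) (\<lambda>x. k (g t x))" and meas: "(\<lambda>x. k (g t x)) \<in> borel_measurable N"
    if "continuous_on UNIV k" "t \<in> space T" for k :: "real \<Rightarrow> real" and t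
  proof -
    have "compact (k ` {0..1})"
      using that by (intro compact_continuous_image) (auto intro: continuous_on_subset)
    then obtain C where C: "\<And>y. y \<in> k ` {0..1} \<Longrightarrow> norm y \<le> C"
      using compact_imp_bounded bounded_iff by metis
    have km: "k \<in> borel_measurable borel"
      using that by (intro borel_measurable_continuous_onI)
    show meas: "(\<lambda>x. k (g t x)) \<in> borel_measurable N"
      using measurable_compose[OF g(2)[OF that(2)] km] .
    then show "integrable (\<rho> t) (\<lambda>x. k (g t x))"
      using C[OF comp] that
      by (intro finite_measure.integrable_const_bound[OF fin, where B = C])
        (simp_all add: measurable_sets_field)
  qed
  have cont: "continuous_on UNIV p" if "real_polynomial_function p" for p :: "real \<Rightarrow> real"
    using continuous_on_polymonial_function[of p UNIV] that
    by (simp add: real_polynomial_function_eq)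
  show ?thesis
    using p
  proof (induction rule: real_polynomial_function.induct)
    case (linear f)
    then obtain c where "f = (\<lambda>x. x * c)"
      using real_bounded_linear by blast
    then show ?case
      using borel_section_cmult[OF g(1), of c] by (simp add: mult.commute)
  next
    case (const c)
    then show ?case by (rule borel_section_const)
  next
    case (add p q)
    then show ?case
      by (intro borel_section_add int cont)
  next
    case (mult p q)
    have p: "continuous_on UNIV p" and q: "continuous_on UNIV q"
      using mult cont by auto
    \<comment> \<open>Left open in \<open>c\<close>, because \<open>c = 1\<close> and
      \<open>c = -1\<close> give the two squares in
      \<open>p q = ((p + q)^2 - (p - q)^2) / 4\<close>.\<close>
    have sq: "borel_section (\<lambda>t x. (p (g t x) + c * q (g t x))\<^sup>2)" for c
    proof (rule borel_section_square)
      show "borel_section (\<lambda>t x. p (g t x) + c * q (g t x))"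
        using int[OF p] int[OF q] mult.IH
        by (intro borel_section_add borel_section_cmult) auto
      show "(\<lambda>x. p (g t x) + c * q (g t x)) \<in> borel_measurable N" if "t \<in> space T" for t
        by (rule meas[of "\<lambda>y. p y + c * q y"]) (intro continuous_intros p q that)+
      show "integrable (\<rho> t) (\<lambda>x. (p (g t x) + c * q (g t x))\<^sup>2)" if "t \<in> space T" for t
        by (rule int[of "\<lambda>y. (p y + c * q y)\<^sup>2"]) (intro continuous_intros p q that)+
    qed
    have sq_int: "integrable (\<rho> t) (\<lambda>x. d * (p (g t x) + c * q (g t x))\<^sup>2)" if "t \<in> space T" for t c d
      by (rule int[of "\<lambda>y. d * (p y + c * q y)\<^sup>2"]) (intro continuous_intros p q that)+
    have "borel_section (\<lambda>t x. 1/4 * (p (g t x) + 1 * q (g t x))\<^sup>2 +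
        (-1/4) * (p (g t x) + (-1) * q (g t x))\<^sup>2)"
      by (intro borel_section_add borel_section_cmult sq sq_int)
    moreover have "1/4 * (a + 1 * b)\<^sup>2 + (-1/4) * (a + (-1) * b)\<^sup>2 = a * b" for a b :: real
      by (simp add: power2_eq_square algebra_simps)
    ultimately show ?case by simp
  qed
qed

lemma borel_section_continuous:
  assumes g: "borel_section g" "\<And>t. t \<in> space T \<Longrightarrow> g t \<in> borel_measurable N"
      "\<And>t x. 0 \<le> g t x" "\<And>t x. g t x \<le> 1"
    and h: "continuous_on UNIV (h :: real \<Rightarrow> real)"
  shows "borel_section (\<lambda>t x. h (g t x))"
  unfolding borel_section_def
proof
  fix A assume A: "A \<in> sets N"
  have "\<exists>p. real_polynomial_function p \<and> (\<forall>y\<in>{0..1}. \<bar>h y - p y\<bar> < 1 / Suc n)" for n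
  proof -
    have "continuous_on {0..1} h"
      using h by (rule continuous_on_subset) simp
    then show ?thesis
      using Stone_Weierstrass_real_polynomial_function[of "{0..1}" h "1 / Suc n"]
      by (metis compact_Icc of_nat_0_less_iff zero_less_Suc zero_less_divide_1_iff)
  qed
  then obtain p where p: "\<And>n. real_polynomial_function (p n)"
      "\<And>n y. y \<in> {0..1} \<Longrightarrow> \<bar>h y - p n y\<bar> < 1 / Suc n"
    by metis
  have "compact (h ` {0..1})"
    using h by (intro compact_continuous_image) (auto intro: continuous_on_subset)
  then obtain C where C: "\<And>y. y \<in> h ` {0..1} \<Longrightarrow> norm y \<le> C"
    using compact_imp_bounded bounded_iff by metis
  have pm: "p n \<in> borel_measurable borel" for n
    using continuous_on_polymonial_function[of "p n" UNIV] p(1)[of n]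
    by (intro borel_measurable_continuous_onI) (simp add: real_polynomial_function_eq)
  have hm: "h \<in> borel_measurable borel"
    using h by (rule borel_measurable_continuous_onI)
  have lim: "(\<lambda>n. LINT x:A|\<rho> t. p n (g t x)) \<longlonglongrightarrow> (LINT x:A|\<rho> t. h (g t x))"
    if t: "t \<in> space T" for t
    unfolding set_lebesgue_integral_def
  \<comment> \<open>\<open>C\<close> bounds \<open>h\<close> on [0,1], and each \<open>p n\<close>
    differs from \<open>h\<close> there by less than \<open>1 / Suc n\<close>, hence by less than
    1.\<close>
  proof (rule integral_dominated_convergence[where w = "\<lambda>x. C + 1"])
    have gm: "g t \<in> borel_measurable (\<rho> t)"
      using g(2)[OF t] t by (simp add: measurable_sets_field)
    have Am: "A \<in> sets (\<rho> t)"
      using A t sets_field by simp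
    show "(\<lambda>x. indicator A x *\<^sub>R h (g t x)) \<in> borel_measurable (\<rho> t)"
      "(\<lambda>x. indicator A x *\<^sub>R p n (g t x)) \<in> borel_measurable (\<rho> t)" for n
      using measurable_compose[OF gm hm] measurable_compose[OF gm pm[of n]] Am by auto
    show "integrable (\<rho> t) (\<lambda>x. C + 1)"
      using finite_measure.integrable_const[OF fin[OF t]] .
    have lim: "(\<lambda>n. p n y) \<longlonglongrightarrow> h y" if "y \<in> {0..1}" for y
    proof (rule LIM_zero_cancel, rule Lim_null_comparison)
      show "\<forall>\<^sub>F n in sequentially. norm (p n y - h y) \<le> 1 / Suc n"
        using p(2)[OF that] by (intro always_eventually) (simp add: abs_minus_commute less_imp_le)
      show "(\<lambda>n. 1 / real (Suc n)) \<longlonglongrightarrow> 0"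
        using LIMSEQ_inverse_real_of_nat by (simp add: inverse_eq_divide)
    qed
    show "AE x in \<rho> t. (\<lambda>n. indicator A x *\<^sub>R p n (g t x)) \<longlonglongrightarrow> indicator A x *\<^sub>R h (g t x)"
      using g(3,4) by (intro AE_I2 tendsto_scaleR tendsto_const lim) auto
    show "AE x in \<rho> t. norm (indicator A x *\<^sub>R p n (g t x)) \<le> C + 1" for n
    proof (rule AE_I2)
      fix x
      have y: "g t x \<in> {0..1}" using g(3,4) by simp
      have "\<bar>p n (g t x)\<bar> \<le> C + 1"
      proof -
        have "1 / real (Suc n) \<le> 1" by simp
        then show ?thesis
          using p(2)[OF y, of n] C[OF imageI[OF y]] unfolding real_norm_def by linarith
      qed
      then show "norm (indicator A x *\<^sub>R p n (g t x)) \<le> C + 1"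
        by (auto simp: indicator_def)
    qed
  qed
  have meas: "(\<lambda>t. LINT x:A|\<rho> t. p n (g t x)) \<in> borel_measurable T" for n
  proof (rule borel_sectionD[OF _ A])
    show "borel_section (\<lambda>t x. p n (g t x))"
      by (rule borel_section_polynomial[where g = g and p = "p n", OF g p(1)])
  qed
  show "(\<lambda>t. LINT x:A|\<rho> t. h (g t x)) \<in> borel_measurable T"
    by (rule borel_measurable_LIMSEQ_real[where u = "\<lambda>n t. LINT x:A|\<rho> t. p n (g t x)"])
      (fact lim, fact meas)
qed

end

text \<open>The density is made bounded by passing to the measure \<open>(1 + f) m\<close>, with respect to which
  \<open>m\<close> has density \<open>g = 1 / (1 + f)\<close> and \<open>sqrt f m\<close> has density \<open>sqrt (g (1 - g))\<close>.\<close>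

lemma borel_measurable_integral_sqrt:
  fixes f :: "'t \<Rightarrow> 'a \<Rightarrow> real"
  assumes field: "measure_field T N m \<A>"
    and f: "\<And>t. t \<in> space T \<Longrightarrow> f t \<in> borel_measurable N" "\<And>t x. 0 \<le> f t x"
      "\<And>t. t \<in> space T \<Longrightarrow> integrable (m t) (f t)"
    and sec: "\<And>A. A \<in> sets N \<Longrightarrow> (\<lambda>t. LINT x:A|m t. f t x) \<in> borel_measurable T"
    and A: "A \<in> sets N"
  shows "(\<lambda>t. LINT x:A|m t. sqrt (f t x)) \<in> borel_measurable T"
proof -
  interpret m: measure_field T N m \<A> by (rule field)
  define \<rho> where "\<rho> t = density (m t) (\<lambda>x. ennreal (1 + f t x))" for t
  define g where "g t x = 1 / (1 + f t x)" for t x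
  have pos: "1 + f t x > 0" for t x
    using f(2)[of t x] by linarith
  have fm: "f t \<in> borel_measurable (m t)" if "t \<in> space T" for t
    by (rule iffD2[OF m.measurable_sets_field[OF that] f(1)[OF that]])
  have gm: "g t \<in> borel_measurable N" if "t \<in> space T" for t
    unfolding g_def using f(1)[OF that] by measurable
  have int1: "integrable (m t) (\<lambda>x. 1 + f t x)" if t: "t \<in> space T" for t
    using t f(3)
    by (intro Bochner_Integration.integrable_add finite_measure.integrable_const m.fin)
  have set_int: "(LINT x:B|\<rho> t. h x) = (LINT x:B|m t. (1 + f t x) * h x)"
    if t: "t \<in> space T" and B: "B \<in> sets N" and h: "h \<in> borel_measurable N"
    for t B and h :: "'a \<Rightarrow> real"
  proof -
    have hm: "h \<in> borel_measurable (m t)" by (rule iffD2[OF m.measurable_sets_field[OF t] h])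
    have Bm: "B \<in> sets (m t)" using B m.sets_field[OF t] by simp
    have "(LINT x|\<rho> t. indicator B x * h x) = (LINT x|m t. (1 + f t x) * (indicator B x * h x))"
      unfolding \<rho>_def using hm Bm fm[OF t] less_imp_le[OF pos]
      by (intro integral_real_density) auto
    then show ?thesis
      by (simp add: set_lebesgue_integral_def algebra_simps)
  qed
  have rho_measure: "measure (\<rho> t) B = measure (m t) B + (LINT x:B|m t. f t x)"
    if t: "t \<in> space T" and B: "B \<in> sets N" for t B
  proof -
    have Bm: "B \<in> sets (m t)" using B m.sets_field[OF t] by simp
    have "measure (\<rho> t) B = (LINT x:B|\<rho> t. 1)"
      using B t by (simp add: set_lebesgue_integral_def \<rho>_def m.sets_field m.space_field Int_absorb2
          sets.sets_into_space)
    also have "\<dots> = (LINT x:B|m t. 1 + f t x)"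
      using set_int[OF t B, of "\<lambda>_. 1"] by simp
    also have "\<dots> = (LINT x:B|m t. 1) + (LINT x:B|m t. f t x)"
      using t B f(3)[OF t] finite_measure.integrable_const[OF m.fin[OF t]]
      by (intro set_integral_add m.set_integrable_field) auto
    also have "(LINT x:B|m t. 1) = measure (m t) B"
      using B t by (simp add: set_lebesgue_integral_def m.sets_field m.space_field Int_absorb2
          sets.sets_into_space)
    finally show ?thesis .
  qed
  interpret r: measure_field T N \<rho> \<A>
  proof (rule measure_field.intro)
    show "algebra (space N) \<A>" "countable \<A>" "sets N = sigma_sets (space N) \<A>"
      by (rule m.alg m.count m.gen)+
    fix t assume t: "t \<in> space T"
    show "sets (\<rho> t) = sets N"
      using m.sets_field[OF t] by (simp add: \<rho>_def)
    have "emeasure (\<rho> t) (space (m t)) = (\<integral>\<^sup>+x. ennreal (1 + f t x) \<partial>m t)"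
      unfolding \<rho>_def using fm[OF t]
      by (subst emeasure_density) (auto intro!: nn_integral_cong)
    also have "\<dots> = ennreal (LINT x|m t. 1 + f t x)"
      using int1[OF t] less_imp_le[OF pos] by (intro nn_integral_eq_integral) auto
    finally have "emeasure (\<rho> t) (space (m t)) < \<infinity>"
      by simp
    then show "finite_measure (\<rho> t)"
      by (intro finite_measureI) (simp add: \<rho>_def)
  next
    fix B assume B: "B \<in> sets N"
    show "(\<lambda>t. measure (\<rho> t) B) \<in> borel_measurable T"
      using borel_measurable_add[OF m.measurable_field[OF B] sec[OF B]] rho_measure[OF _ B]
      by (simp cong: measurable_cong)
  qed
  have "r.borel_section g"
    unfolding r.borel_section_def
  proof
    fix B assume B: "B \<in> sets N"
    have "(LINT x:B|\<rho> t. g t x) = measure (m t) B" if t: "t \<in> space T" for t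
    proof -
      have "(1 + f t x) * g t x = 1" for x
        using pos[of t x] by (simp add: g_def)
      then have "(LINT x:B|\<rho> t. g t x) = (LINT x:B|m t. 1)"
        using set_int[OF t B gm[OF t]] by simp
      also have "\<dots> = measure (m t) B"
        using B t by (simp add: set_lebesgue_integral_def m.sets_field m.space_field Int_absorb2
            sets.sets_into_space)
      finally show ?thesis .
    qed
    then show "(\<lambda>t. LINT x:B|\<rho> t. g t x) \<in> borel_measurable T"
      using m.measurable_field[OF B] by (simp cong: measurable_cong)
  qed
  moreover have "0 \<le> g t x" "g t x \<le> 1" for t x
    using f(2)[of t x] by (auto simp: g_def)
  \<comment> \<open>Since \<open>g (1 - g) = f / (1 + f)^2\<close>, the weight \<open>1 + f\<close>
    of \<open>\<rho>\<close> turns this function of \<open>g\<close> into \<open>sqrt f\<close>.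
    Continuity holds on the whole line because \<open>sqrt\<close> is extended to negative arguments
    as an odd function.\<close>
  moreover have "continuous_on UNIV (\<lambda>y::real. sqrt (y * (1 - y)))"
    by (intro continuous_intros)
  ultimately have "r.borel_section (\<lambda>t x. sqrt (g t x * (1 - g t x)))"
    using gm by (intro r.borel_section_continuous[where h = "\<lambda>y. sqrt (y * (1 - y))"])
  then have "(\<lambda>t. LINT x:A|\<rho> t. sqrt (g t x * (1 - g t x))) \<in> borel_measurable T"
    using A by (rule r.borel_sectionD)
  moreover have "(LINT x:A|\<rho> t. sqrt (g t x * (1 - g t x))) = (LINT x:A|m t. sqrt (f t x))"
    if t: "t \<in> space T" for t
  proof -
    have "(1 + f t x) * sqrt (g t x * (1 - g t x)) = sqrt (f t x)" for x
    proof -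
      have "g t x * (1 - g t x) = f t x / (1 + f t x)\<^sup>2"
        using pos[of t x] by (simp add: g_def field_simps power2_eq_square)
      then show ?thesis
        using pos[of t x] by (simp add: real_sqrt_divide)
    qed
    moreover have "(\<lambda>x. sqrt (g t x * (1 - g t x))) \<in> borel_measurable N"
      using gm[OF t] by measurable
    ultimately show ?thesis
      using set_int[OF t A] by simp
  qed
  ultimately show ?thesis
    by (simp cong: measurable_cong)
qed

section \<open>Subdivision of times, and rings without a unit\<close>

text \<open>Cut \<open>t\<close> into equal pieces shorter than \<open>t0\<close>: the property
  descends from \<open>t0\<close> to one piece and then ascends to \<open>t\<close> by adding
  pieces. It is applied to the nonvanishing of the atom at the empty set and of the norm of a
  unit.\<close>

lemma divisible_semigroup_pred:
  fixes t t0 :: real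
  assumes iff: "\<And>s t. s > 0 \<Longrightarrow> t > 0 \<Longrightarrow> P (s + t) \<longleftrightarrow> P s \<and> P t"
    and "P t0" "t0 > 0" "t > 0"
  shows "P t"
proof -
  obtain n where n: "t / t0 < real (Suc n)"
    using reals_Archimedean2[of "t / t0"] by (metis less_trans of_nat_less_iff lessI)
  define r where "r = t / real (Suc n)"
  have r: "0 < r" "r < t0"
    using n assms by (auto simp: r_def field_simps simp del: of_nat_Suc)
  then have "P r"
    using iff[of r "t0 - r"] assms by simp
  have "P (real (Suc k) * r)" for k
  proof (induction k)
    case (Suc k)
    have "real (Suc (Suc k)) * r = real (Suc k) * r + r"
      by (simp add: algebra_simps)
    then show ?case
      using iff[of "real (Suc k) * r" r] r Suc \<open>P r\<close> by (simp del: of_nat_Suc)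
  qed (use \<open>P r\<close> in simp)
  from this[of n] show ?thesis
    by (simp add: r_def del: of_nat_Suc)
qed

text \<open>A ring may lack the whole space, while L^2 approximation needs an algebra. Adjoining
  complements suffices, because a union involving a complement is the complement of a difference or
  an intersection; countability is preserved.\<close>

lemma algebra_ring_complements:
  assumes "ring_of_sets \<Omega> R"
  shows "algebra \<Omega> (R \<union> (\<lambda>A. \<Omega> - A) ` R)"
proof -
  interpret ring_of_sets \<Omega> R by fact
  have sub: "A \<subseteq> \<Omega>" if "A \<in> R" for A
    using that space_closed by blast
  show ?thesis
    unfolding algebra_iff_Un
  proof (intro conjI ballI)
    fix A assume "A \<in> R \<union> (\<lambda>A. \<Omega> - A) ` R"
    then show "\<Omega> - A \<in> R \<union> (\<lambda>A. \<Omega> - A) ` R"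
      using sub by (auto simp: double_diff)
    fix B assume "B \<in> R \<union> (\<lambda>A. \<Omega> - A) ` R"
    with \<open>A \<in> _\<close> consider "A \<in> R" "B \<in> R" | B' where "A \<in> R" "B' \<in> R" "B = \<Omega> - B'"
      | A' where "A' \<in> R" "A = \<Omega> - A'" "B \<in> R"
      | A' B' where "A' \<in> R" "B' \<in> R" "A = \<Omega> - A'" "B = \<Omega> - B'"
      by blast
    then show "A \<union> B \<in> R \<union> (\<lambda>A. \<Omega> - A) ` R"
    proof cases
      case 1
      then show ?thesis by auto
    next
      case 2
      have "A \<union> B = \<Omega> - (B' - A)" using 2 sub by blast
      then show ?thesis using 2 by blast
    next
      case 3
      have "A \<union> B = \<Omega> - (A' - B)" using 3 sub by blast
      then show ?thesis using 3 by blast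
    next
      case 4
      have "A \<union> B = \<Omega> - (A' \<inter> B')" using 4 sub by blast
      then show ?thesis using 4 by blast
    qed
  qed (use sub in auto)
qed

lemma sigma_sets_ring_complements:
  assumes "R \<subseteq> Pow \<Omega>"
  shows "sigma_sets \<Omega> (R \<union> (\<lambda>A. \<Omega> - A) ` R) = sigma_sets \<Omega> R"
  by (rule sigma_sets_eqI) (auto intro: sigma_sets.Basic sigma_sets.Compl)

section \<open>Factorizing families\<close>

locale factorizing_family =
  fixes \<mu> :: "real \<Rightarrow> (real \<times> 'l::{t2_space, second_countable_topology}) set measure"
    and R :: "(real \<times> 'l) set set set"
  assumes lc: "locally_compact_space (euclidean :: 'l topology)"
    and fam: "measurable_factorizing_family \<mu> R"
begin

lemma prob: "t > 0 \<Longrightarrow> prob_space (\<mu> t)"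
  and sets_mu: "t > 0 \<Longrightarrow> sets (\<mu> t) = sets (Cmeas t)"
  and conv_ac: "s > 0 \<Longrightarrow> t > 0 \<Longrightarrow> absolutely_continuous (\<mu> (s + t)) (conv s t (\<mu> s) (\<mu> t))"
  and ac_conv: "s > 0 \<Longrightarrow> t > 0 \<Longrightarrow> absolutely_continuous (conv s t (\<mu> s) (\<mu> t)) (\<mu> (s + t))"
  and null_fibre: "t > 0 \<Longrightarrow> r \<in> {0..t} \<Longrightarrow>
    emeasure (\<mu> t) {Z \<in> Cspace t. Z \<inter> ({r} \<times> UNIV) \<noteq> {}} = 0"
  and countable_R: "countable R" and ring_R: "ring_of_sets (Cspace 1) R"
  and gen_R: "sigma_sets (Cspace 1) R = sets (Cmeas 1)"
  and kernel_R: "A \<in> R \<Longrightarrow>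
    (\<lambda>t. measure (distr (\<mu> t) (Cmeas 1) (rescale t)) A) \<in> borel_measurable pos_reals"
  using fam unfolding measurable_factorizing_family_def
  by (simp_all add: space_prob_algebra)

lemma space_mu: "t > 0 \<Longrightarrow> space (\<mu> t) = Cspace t"
  using sets_eq_imp_space_eq[OF sets_mu] by simp

lemma R_subset: "R \<subseteq> Pow (Cspace 1)"
  using ring_R by (simp add: ring_of_sets_iff)

lemma R_sets: "A \<in> R \<Longrightarrow> A \<in> sets (Cmeas 1)"
  using gen_R by auto

lemma space_pos_reals [simp]: "space pos_reals = {0<..}"
  by (simp add: pos_reals_def space_restrict_space)

lemma measurable_mu: "t > 0 \<Longrightarrow> f \<in> measurable (\<mu> t) N \<longleftrightarrow> f \<in> measurable (Cmeas t) N"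
  using measurable_cong_sets[OF sets_mu refl] by auto

lemma AE_no_fibre:
  assumes "t > 0" "r \<in> {0..t}"
  shows "AE Z in \<mu> t. Z \<inter> ({r} \<times> UNIV) = {}"
proof (rule AE_I')
  have "{Z \<in> Cspace t. Z \<inter> ({r} \<times> (UNIV :: 'l set)) \<noteq> {}} \<in> sets (Cmeas t)"
    by (intro hit_closed_sets lc closed_Times) auto
  then show "{Z \<in> Cspace t. Z \<inter> ({r} \<times> (UNIV :: 'l set)) \<noteq> {}} \<in> null_sets (\<mu> t)"
    using null_fibre[OF assms] sets_mu[OF assms(1)] by (simp add: null_sets_def)
  show "{Z \<in> space (\<mu> t). Z \<inter> {r} \<times> UNIV \<noteq> {}} \<subseteq> {Z \<in> Cspace t. Z \<inter> ({r} \<times> UNIV) \<noteq> {}}"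
    using space_mu[OF assms(1)] by simp
qed

lemma measurable_oplus_mu:
  assumes "s > 0" "t > 0"
  shows "oplus s \<in> measurable (\<mu> s \<Otimes>\<^sub>M \<mu> t) (Cmeas (s + t))"
proof -
  have "sets (\<mu> s \<Otimes>\<^sub>M \<mu> t) = sets (Cmeas s \<Otimes>\<^sub>M Cmeas t)"
    using assms by (intro sets_pair_measure_cong sets_mu)
  then show ?thesis
    using measurable_oplus[OF lc assms] measurable_cong_sets by blast
qed

section \<open>Convolution of measures with densities\<close>

text \<open>Restriction can fail to undo the union only if the first set meets time \<open>s\<close>
  or the second meets time \<open>0\<close>. Each event concerns one marginal, where a fixed fibre
  is null.\<close>

lemma AE_pieces_oplus:
  assumes "s > 0" "t > 0"
  shows "AE p in \<mu> s \<Otimes>\<^sub>M \<mu> t. left_piece s (oplus s p) = fst p \<and> right_piece s t (oplus s p) = snd p"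
proof -
  interpret s: prob_space "\<mu> s" using assms by (intro prob)
  interpret t: prob_space "\<mu> t" using assms by (intro prob)
  interpret pair_prob_space "\<mu> s" "\<mu> t" ..
  have "AE Z in distr (\<mu> s \<Otimes>\<^sub>M \<mu> t) (\<mu> s) fst. Z \<inter> ({s} \<times> UNIV) = {}"
    unfolding t.distr_pair_fst using assms by (intro AE_no_fibre) auto
  then have 1: "AE p in \<mu> s \<Otimes>\<^sub>M \<mu> t. fst p \<inter> ({s} \<times> UNIV) = {}"
    by (rule AE_distrD[OF measurable_fst])
  have distr_snd: "distr (\<mu> s \<Otimes>\<^sub>M \<mu> t) (\<mu> t) snd = \<mu> t"
  proof (rule measure_eqI)
    fix A assume "A \<in> sets (distr (\<mu> s \<Otimes>\<^sub>M \<mu> t) (\<mu> t) snd)"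
    then have A: "A \<in> sets (\<mu> t)" by simp
    have "snd -` A \<inter> space (\<mu> s \<Otimes>\<^sub>M \<mu> t) = space (\<mu> s) \<times> A"
      using sets.sets_into_space[OF A] by (auto simp: space_pair_measure)
    then show "emeasure (distr (\<mu> s \<Otimes>\<^sub>M \<mu> t) (\<mu> t) snd) A = emeasure (\<mu> t) A"
      using A by (simp add: emeasure_distr t.emeasure_pair_measure_Times s.emeasure_space_1)
  qed simp
  have "AE Z in distr (\<mu> s \<Otimes>\<^sub>M \<mu> t) (\<mu> t) snd. Z \<inter> ({0} \<times> UNIV) = {}"
    unfolding distr_snd using assms by (intro AE_no_fibre) auto
  then have 2: "AE p in \<mu> s \<Otimes>\<^sub>M \<mu> t. snd p \<inter> ({0} \<times> UNIV) = {}"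
    by (rule AE_distrD[OF measurable_snd])
  from 1 2 AE_space show ?thesis
  proof eventually_elim
    case (elim p)
    then show ?case
      using left_piece_oplus[of "fst p" s "snd p" t] right_piece_oplus[of "fst p" s "snd p" t]
        space_mu[OF assms(1)] space_mu[OF assms(2)] by (auto simp: space_pair_measure)
  qed
qed

lemma Delta_measurable:
  assumes "s > 0" "t > 0"
  shows "Delta \<mu> s t \<in> borel_measurable (Cmeas (s + t))"
proof -
  have "Delta \<mu> s t \<in> borel_measurable (\<mu> (s + t))"
    unfolding Delta_def by measurable
  then show ?thesis
    using assms by (simp add: measurable_mu)
qed

lemma conv_eq_density_Delta:
  assumes "s > 0" "t > 0"
  shows "conv s t (\<mu> s) (\<mu> t) = density (\<mu> (s + t)) (\<lambda>Z. ennreal (Delta \<mu> s t Z))"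
proof -
  interpret s: prob_space "\<mu> s" using assms by (intro prob)
  interpret t: prob_space "\<mu> t" using assms by (intro prob)
  interpret pair_prob_space "\<mu> s" "\<mu> t" ..
  interpret st: prob_space "\<mu> (s + t)" using assms by (intro prob) simp
  have conv: "sets (conv s t (\<mu> s) (\<mu> t)) = sets (\<mu> (s + t))"
    using assms by (simp add: conv_def sets_mu)
  interpret c: prob_space "conv s t (\<mu> s) (\<mu> t)"
    unfolding conv_def by (intro prob_space_distr measurable_oplus_mu assms)
  \<comment> \<open>\<open>enn2real\<close> in \<open>Delta\<close> sends infinity to 0; finiteness
    almost everywhere ensures that nothing is lost.\<close>
  have "AE Z in \<mu> (s + t). RN_deriv (\<mu> (s + t)) (conv s t (\<mu> s) (\<mu> t)) Z \<noteq> \<infinity>"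
    by (intro st.RN_deriv_finite c.sigma_finite_measure_axioms conv_ac conv assms)
  then have "AE Z in \<mu> (s + t). RN_deriv (\<mu> (s + t)) (conv s t (\<mu> s) (\<mu> t)) Z =
      ennreal (Delta \<mu> s t Z)"
    by eventually_elim (simp add: Delta_def top.not_eq_extremum)
  moreover have "(\<lambda>Z. ennreal (Delta \<mu> s t Z)) \<in> borel_measurable (\<mu> (s + t))"
    using Delta_measurable[OF assms] assms by (simp add: measurable_mu)
  ultimately have "density (\<mu> (s + t)) (RN_deriv (\<mu> (s + t)) (conv s t (\<mu> s) (\<mu> t))) =
      density (\<mu> (s + t)) (\<lambda>Z. ennreal (Delta \<mu> s t Z))"
    by (intro density_cong) auto
  then show ?thesis
    using st.density_RN_deriv[OF conv_ac[OF assms] conv] by simp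
qed

text \<open>Almost surely both sets can be read off their union, so \<open>F x * H y\<close> is a
  function of \<open>oplus s (x, y)\<close>. A density of this form passes through the image
  measure, and \<open>Delta\<close> then changes the reference measure to
  \<open>\<mu> (s + t)\<close>.\<close>

lemma conv_density:
  assumes st: "s > 0" "t > 0"
    and F: "F \<in> borel_measurable (Cmeas s)" and H: "H \<in> borel_measurable (Cmeas t)"
    and fin: "sigma_finite_measure (density (\<mu> t) H)"
  shows "conv s t (density (\<mu> s) F) (density (\<mu> t) H) =
    density (\<mu> (s + t)) (\<lambda>Z. ennreal (Delta \<mu> s t Z) * (F (left_piece s Z) * H (right_piece s t Z)))"
proof -
  interpret s: prob_space "\<mu> s" using st by (intro prob)
  interpret t: prob_space "\<mu> t" using st by (intro prob)
  let ?G = "\<lambda>Z. F (left_piece s Z) * H (right_piece s t Z)"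
  have F': "F \<in> borel_measurable (\<mu> s)" and H': "H \<in> borel_measurable (\<mu> t)"
    using st F H by (simp_all add: measurable_mu)
  have G: "?G \<in> borel_measurable (Cmeas (s + t))"
    by (rule borel_measurable_times_ennreal[OF measurable_compose[OF measurable_left_piece[OF lc] F]
          measurable_compose[OF measurable_right_piece[OF lc] H]])
  then have G': "?G \<in> borel_measurable (\<mu> (s + t))"
    using st by (simp add: measurable_mu)
  have D: "(\<lambda>Z. ennreal (Delta \<mu> s t Z)) \<in> borel_measurable (\<mu> (s + t))"
    using Delta_measurable[OF st] st by (simp add: measurable_mu)
  have "density (\<mu> s) F \<Otimes>\<^sub>M density (\<mu> t) H = density (\<mu> s \<Otimes>\<^sub>M \<mu> t) (\<lambda>(x, y). F x * H y)"
    by (rule pair_measure_density[OF F' H' t.sigma_finite_measure_axioms fin])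
  also have "\<dots> = density (\<mu> s \<Otimes>\<^sub>M \<mu> t) (\<lambda>p. ?G (oplus s p))"
  proof (rule density_cong)
    show "(\<lambda>(x, y). F x * H y) \<in> borel_measurable (\<mu> s \<Otimes>\<^sub>M \<mu> t)"
      using F' H' by measurable
    show "(\<lambda>p. ?G (oplus s p)) \<in> borel_measurable (\<mu> s \<Otimes>\<^sub>M \<mu> t)"
      by (rule measurable_compose[OF measurable_oplus_mu[OF st] G])
    show "AE p in \<mu> s \<Otimes>\<^sub>M \<mu> t. (case p of (x, y) \<Rightarrow> F x * H y) = ?G (oplus s p)"
      using AE_pieces_oplus[OF st] by eventually_elim (auto simp: split_beta)
  qed
  finally have "conv s t (density (\<mu> s) F) (density (\<mu> t) H) =
      distr (density (\<mu> s \<Otimes>\<^sub>M \<mu> t) (\<lambda>p. ?G (oplus s p))) (Cmeas (s + t)) (oplus s)"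
    by (simp add: conv_def)
  also have "\<dots> = density (conv s t (\<mu> s) (\<mu> t)) ?G"
    unfolding conv_def by (rule density_distr[OF G measurable_oplus_mu[OF st], symmetric])
  also have "\<dots> = density (\<mu> (s + t)) (\<lambda>Z. ennreal (Delta \<mu> s t Z) * ?G Z)"
    unfolding conv_eq_density_Delta[OF st] by (rule density_density_eq[OF D G'])
  finally show ?thesis .
qed

section \<open>Transport to the unit interval\<close>

definition rescaled :: "(real \<Rightarrow> (real \<times> 'l) set measure) \<Rightarrow> real \<Rightarrow> (real \<times> 'l) set measure" where
  "rescaled \<kappa> t = distr (\<kappa> t) (Cmeas 1) (rescale t)"

lemma measurable_rescale_unit:
  assumes "t > 0"
  shows "rescale t \<in> measurable (Cmeas t :: (real \<times> 'l) set measure) (Cmeas 1)"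
    and "rescale (1 / t) \<in> measurable (Cmeas 1 :: (real \<times> 'l) set measure) (Cmeas t)"
  using measurable_rescale[OF lc assms, of 1] measurable_rescale[OF lc, of "1 / t" t] assms by auto

lemma integral_rescaled:
  fixes f :: "(real \<times> 'l) set \<Rightarrow> 'b::{banach, second_countable_topology}"
  assumes t: "t > 0" and f: "f \<in> borel_measurable (Cmeas t)" and A: "A \<in> sets (Cmeas 1)"
  shows "(LINT x:A|rescaled \<mu> t. f (rescale (1 / t) x)) =
      (LINT Z|\<mu> t. indicator A (rescale t Z) *\<^sub>R f Z)"
proof -
  have r: "rescale t \<in> measurable (\<mu> t) (Cmeas 1)"
    using measurable_rescale_unit(1)[OF t] t by (simp add: measurable_mu)
  have f': "(\<lambda>x. f (rescale (1 / t) x)) \<in> borel_measurable (Cmeas 1)"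
    by (rule measurable_compose[OF measurable_rescale_unit(2)[OF t] f])
  show ?thesis
    unfolding set_lebesgue_integral_def rescaled_def
    by (subst integral_distr[OF r]) (use f' A in \<open>auto simp: rescale_inverse(1)[OF t]\<close>)
qed

lemma integrable_rescaled:
  fixes f :: "(real \<times> 'l) set \<Rightarrow> 'b::{banach, second_countable_topology}"
  assumes t: "t > 0" and f: "integrable (\<mu> t) f"
  shows "integrable (rescaled \<mu> t) (\<lambda>x. f (rescale (1 / t) x))"
proof -
  have r: "rescale t \<in> measurable (\<mu> t) (Cmeas 1)"
    using measurable_rescale_unit(1)[OF t] t by (simp add: measurable_mu)
  have "f \<in> borel_measurable (Cmeas t)"
    using borel_measurable_integrable[OF f] t by (simp add: measurable_mu)
  then have f': "(\<lambda>x. f (rescale (1 / t) x)) \<in> borel_measurable (Cmeas 1)"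
    by (rule measurable_compose[OF measurable_rescale_unit(2)[OF t]])
  show ?thesis
    unfolding rescaled_def integrable_distr_eq[OF r f'] rescale_inverse(1)[OF t] by (rule f)
qed

lemma Int_stable_R: "Int_stable R"
proof -
  interpret ring_of_sets "Cspace 1" R by (rule ring_R)
  show ?thesis by (auto simp: Int_stable_def)
qed

definition alg_R :: "(real \<times> 'l) set set set" where
  "alg_R = R \<union> (\<lambda>A. Cspace 1 - A) ` R"

text \<open>Borel dependence is given on \<open>R\<close> only. For probability measures the total
  mass is constant, so complements cause no trouble, even if \<open>R\<close> does not exhaust
  \<open>Cspace 1\<close>.\<close>

lemma measure_field_rescaled:
  assumes \<kappa>: "\<And>t. t > 0 \<Longrightarrow> prob_space (\<kappa> t)" "\<And>t. t > 0 \<Longrightarrow> sets (\<kappa> t) = sets (Cmeas t)"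
    and meas: "\<And>A. A \<in> R \<Longrightarrow> (\<lambda>t. measure (rescaled \<kappa> t) A) \<in> borel_measurable pos_reals"
  shows "measure_field pos_reals (Cmeas 1) (rescaled \<kappa>) alg_R"
proof (rule measure_field.intro)
  have prob: "prob_space (rescaled \<kappa> t)" if t: "t > 0" for t
    unfolding rescaled_def
    using measurable_rescale_unit(1)[OF t] measurable_cong_sets[OF \<kappa>(2)[OF t] refl]
    by (intro prob_space.prob_space_distr \<kappa>(1) t) blast
  then show "finite_measure (rescaled \<kappa> t)" if "t \<in> space pos_reals" for t
    using that by (simp add: prob_space.finite_measure)
  show sets: "sets (rescaled \<kappa> t) = sets (Cmeas 1)" for t
    by (simp add: rescaled_def)
  show "algebra (space (Cmeas 1)) alg_R"
    unfolding alg_R_def using algebra_ring_complements[OF ring_R] by simp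
  show "countable alg_R"
    unfolding alg_R_def using countable_R by simp
  show "sets (Cmeas 1) = sigma_sets (space (Cmeas 1)) alg_R"
    unfolding alg_R_def using sigma_sets_ring_complements[OF R_subset] gen_R by simp
  fix A :: "(real \<times> 'l) set set" assume A: "A \<in> sets (Cmeas 1)"
  have eq: "(LINT x:B|rescaled \<kappa> t. (1::real)) = measure (rescaled \<kappa> t) B" if "B \<in> sets (Cmeas 1)" for B t
    using that sets.sets_into_space[OF that]
    by (simp add: set_lebesgue_integral_def rescaled_def Int_absorb2)
  have "(\<lambda>t. LINT x:A|rescaled \<kappa> t. (1::real)) \<in> borel_measurable pos_reals"
  proof (rule borel_measurable_set_integral_generated[OF Int_stable_R _ _ sets _ _ _ A])
    show "R \<subseteq> Pow (space (Cmeas 1))" "sets (Cmeas 1) = sigma_sets (space (Cmeas 1)) R"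
      using R_subset gen_R by simp_all
    show "integrable (rescaled \<kappa> t) (\<lambda>x. 1)" if "t \<in> space pos_reals" for t
      using prob[of t] that by (simp add: prob_space.finite_measure finite_measure.integrable_const)
    show "(\<lambda>t. LINT x:B|rescaled \<kappa> t. (1::real)) \<in> borel_measurable pos_reals" if "B \<in> R" for B
      using meas[OF that] eq[OF R_sets[OF that]] by simp
    have "(LINT x|rescaled \<kappa> t. (1::real)) = 1" if "t \<in> space pos_reals" for t
      using prob_space.prob_space[OF prob[of t]] that by simp
    then show "(\<lambda>t. LINT x|rescaled \<kappa> t. (1::real)) \<in> borel_measurable pos_reals"
      by (subst measurable_cong[where g = "\<lambda>_. 1"]) (assumption, simp)
  qed
  then show "(\<lambda>t. measure (rescaled \<kappa> t) A) \<in> borel_measurable pos_reals"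
    using eq[OF A] by simp
qed

lemma measure_field_mu: "measure_field pos_reals (Cmeas 1) (rescaled \<mu>) alg_R"
  using kernel_R by (intro measure_field_rescaled prob sets_mu) (auto simp: rescaled_def)

section \<open>The atom at the empty set and the coverage by the ring\<close>

lemma empty_sets: "{{}} \<in> sets (Cmeas t :: (real \<times> 'l) set measure)"
proof -
  have "{Z \<in> Cspace t. Z \<inter> (UNIV :: (real \<times> 'l) set) = {}} \<in> sets (Cmeas t)"
    by (rule hit_closed_sets(2)[OF lc closed_UNIV])
  moreover have "{Z \<in> Cspace t. Z \<inter> (UNIV :: (real \<times> 'l) set) = {}} = {{}}"
    by auto
  ultimately show ?thesis by simp
qed

text \<open>A union is empty exactly when both parts are, so for the convolution the atoms multiply;
  mutual absolute continuity carries their vanishing over to \<open>\<mu> (s + t)\<close>.\<close>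

lemma empty_atom_iff:
  assumes "s > 0" "t > 0"
  shows "emeasure (\<mu> (s + t)) {{}} \<noteq> 0 \<longleftrightarrow> emeasure (\<mu> s) {{}} \<noteq> 0 \<and> emeasure (\<mu> t) {{}} \<noteq> 0"
proof -
  interpret t: prob_space "\<mu> t" using assms by (intro prob)
  have e: "{{}} \<in> sets (\<mu> s)" "{{}} \<in> sets (\<mu> t)" "{{}} \<in> sets (\<mu> (s + t))"
    using assms empty_sets by (auto simp: sets_mu)
  have "oplus s -` {{}} \<inter> space (\<mu> s \<Otimes>\<^sub>M \<mu> t) = {{}} \<times> {{}}"
    using assms by (auto simp: oplus_def shift_def space_pair_measure space_mu)
  then have "emeasure (conv s t (\<mu> s) (\<mu> t)) {{}} = emeasure (\<mu> s) {{}} * emeasure (\<mu> t) {{}}"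
    unfolding conv_def using emeasure_distr[OF measurable_oplus_mu[OF assms] empty_sets]
      t.emeasure_pair_measure_Times[OF e(1,2)] by simp
  moreover have "emeasure (\<mu> (s + t)) {{}} = 0 \<longleftrightarrow> emeasure (conv s t (\<mu> s) (\<mu> t)) {{}} = 0"
  proof -
    have "{{}} \<in> sets (conv s t (\<mu> s) (\<mu> t))"
      using empty_sets by (simp add: conv_def)
    then show ?thesis
      using conv_ac[OF assms] ac_conv[OF assms] e(3)
      unfolding absolutely_continuous_def null_sets_def by blast
  qed
  ultimately show ?thesis by simp
qed

text \<open>A point missed by the ring \<open>R\<close> cannot be separated from any other such point, so all missed
  sets share a fibre with a fixed one unless the missed point is the empty set.\<close>

lemma AE_rescale_in_Union:
  assumes e: "emeasure (\<mu> t) {{}} = 0" and t: "t > 0"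
  shows "AE Z in \<mu> t. rescale t Z \<in> \<Union>R"
proof (cases "Cspace 1 \<subseteq> \<Union>R")
  case True
  show ?thesis
  proof (rule AE_I2)
    fix Z assume "Z \<in> space (\<mu> t)"
    then have "rescale t Z \<in> Cspace 1"
      using t by (intro rescale_in_Cspace) (auto simp: space_mu)
    then show "rescale t Z \<in> \<Union>R" using True by blast
  qed
next
  case False
  then obtain p where p: "p \<in> Cspace 1" "p \<notin> \<Union>R" by blast
  \<comment> \<open>The sets that do not separate \<open>p\<close> from \<open>q\<close> form a
    sigma-field, and it contains \<open>R\<close>, whose members contain neither point.\<close>
  have sep: "p \<in> A \<longleftrightarrow> q \<in> A" if A: "A \<in> sets (Cmeas 1)" and q: "q \<in> Cspace 1" "q \<notin> \<Union>R" for A q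
    using A unfolding gen_R[symmetric]
    by induction (use p q in auto)
  have q: "rescale t Z \<in> Cspace 1" if "Z \<in> space (\<mu> t)" for Z
    using t that by (intro rescale_in_Cspace) (auto simp: space_mu)
  show ?thesis
  proof (cases "p = {}")
    case True
    have "AE Z in \<mu> t. Z \<notin> {{}}"
      using e t empty_sets by (intro AE_not_in) (simp add: null_sets_def sets_mu)
    with AE_space show ?thesis
    proof eventually_elim
      case (elim Z)
      then have "rescale t Z \<notin> {{}}" by (auto simp: rescale_def)
      then show ?case
        using sep[OF empty_sets, of "rescale t Z"] q[of Z] elim True by blast
    qed
  next
    case False
    then obtain r l where rl: "(r, l) \<in> p" by auto
    have r: "r \<in> {0..1}" using p rl by (auto simp: Cspace_def)
    let ?A = "{Z \<in> Cspace 1. Z \<inter> ({r} \<times> (UNIV :: 'l set)) \<noteq> {}}"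
    have A: "?A \<in> sets (Cmeas 1)"
      by (intro hit_closed_sets lc closed_Times) auto
    \<comment> \<open>Time \<open>r\<close> after rescaling is time \<open>t * r\<close> before it,
      so the missed sets lie in a null event.\<close>
    have "AE Z in \<mu> t. Z \<inter> ({t * r} \<times> UNIV) = {}"
      using r t by (intro AE_no_fibre) (auto simp: mult_left_le)
    with AE_space show ?thesis
    proof eventually_elim
      case (elim Z)
      have "rescale t Z \<notin> ?A"
        using elim t by (auto simp: rescale_def)
      moreover have "p \<in> ?A" using p rl by auto
      ultimately show ?case
        using sep[OF A, of "rescale t Z"] q[of Z] elim by blast
    qed
  qed
qed

text \<open>Serves unnormalised densities: applied to the squared modulus of a unit it makes the
  squared norm multiplicative in time.\<close>

lemma emeasure_conv_space:
  fixes M N :: "(real \<times> 'l) set measure"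
  assumes st: "s > 0" "t > 0" and sets: "sets M = sets (Cmeas s)" "sets N = sets (Cmeas t)"
    and fin: "sigma_finite_measure N"
  shows "emeasure (conv s t M N) (Cspace (s + t)) = emeasure M (Cspace s) * emeasure N (Cspace t)"
proof -
  interpret sigma_finite_measure N by (rule fin)
  have o: "oplus s \<in> measurable (M \<Otimes>\<^sub>M N) (Cmeas (s + t))"
    unfolding measurable_cong_sets[OF sets_pair_measure_cong[OF sets] refl]
    by (rule measurable_oplus[OF lc st])
  have sp: "space M = Cspace s" "space N = Cspace t"
    using sets_eq_imp_space_eq[OF sets(1)] sets_eq_imp_space_eq[OF sets(2)] by auto
  have "oplus s -` Cspace (s + t) \<inter> space (M \<Otimes>\<^sub>M N) = space M \<times> space N"
    using measurable_space[OF o] by (auto simp: space_pair_measure)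
  then have "emeasure (conv s t M N) (Cspace (s + t)) = emeasure (M \<Otimes>\<^sub>M N) (space M \<times> space N)"
    unfolding conv_def
    using emeasure_distr[OF o] sets.top[of "Cmeas (s + t) :: (real \<times> 'l) set measure"] by simp
  also have "\<dots> = emeasure M (space M) * emeasure N (space N)"
    by (rule emeasure_pair_measure_Times) auto
  finally show ?thesis by (simp add: sp)
qed

text \<open>Only sets of the ring are tested in the definition of a Borel section; since the ring
  covers almost everything, this extends to all measurable sets.\<close>

lemma section_from_ring:
  fixes w :: "real \<Rightarrow> (real \<times> 'l) set \<Rightarrow> real"
  assumes e: "\<And>t. t > 0 \<Longrightarrow> emeasure (\<mu> t) {{}} = 0"
    and int: "\<And>t. t > 0 \<Longrightarrow> integrable (rescaled \<mu> t) (w t)"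
    and gen: "\<And>A. A \<in> R \<Longrightarrow> (\<lambda>t. LINT x:A|rescaled \<mu> t. w t x) \<in> borel_measurable pos_reals"
    and A: "A \<in> sets (Cmeas 1)"
  shows "(\<lambda>t. LINT x:A|rescaled \<mu> t. w t x) \<in> borel_measurable pos_reals"
proof -
  interpret ring_of_sets "Cspace 1" R by (rule ring_R)
  \<comment> \<open>Finite unions stay in the ring, so these are increasing test sets exhausting
    \<open>\<Union>R\<close>; the integral over the whole space becomes a limit of Borel
    functions.\<close>
  define D where "D n = (\<Union>i\<le>n. from_nat_into R i)" for n :: nat
  have R_ne: "R \<noteq> {}" using empty_sets by auto
  have D: "D n \<in> R" for n
    unfolding D_def using from_nat_into[OF R_ne] by (intro finite_UN) auto
  have D_Un: "(\<Union>n. D n) = \<Union>R"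
  proof -
    have "\<Union>R = (\<Union>i. from_nat_into R i)"
      using range_from_nat_into[OF R_ne countable_R] by simp
    then show ?thesis by (auto simp: D_def)
  qed
  have D_inc: "incseq D"
    unfolding incseq_def D_def by (intro allI impI UN_mono) auto
  have sets_r: "sets (rescaled \<mu> t) = sets (Cmeas 1)" for t
    by (simp add: rescaled_def)
  have lim: "(\<lambda>n. LINT x:D n|rescaled \<mu> t. w t x) \<longlonglongrightarrow> (LINT x|rescaled \<mu> t. w t x)"
    if t: "t \<in> space pos_reals" for t
  proof -
    have t0: "t > 0" using t by simp
    have Dm: "D n \<in> sets (rescaled \<mu> t)" for n
      using R_sets[OF D] sets_r by simp
    have Um: "(\<Union>n. D n) \<in> sets (rescaled \<mu> t)"
      using Dm by auto
    have "set_integrable (rescaled \<mu> t) (\<Union>n. D n) (w t)"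
      unfolding set_integrable_def using int[OF t0] Um by (intro integrable_mult_indicator)
    then have "(\<lambda>n. LINT x:D n|rescaled \<mu> t. w t x) \<longlonglongrightarrow> (LINT x:(\<Union>n. D n)|rescaled \<mu> t. w t x)"
      using Dm D_inc by (intro set_integral_cont_up)
    moreover have "(LINT x:(\<Union>n. D n)|rescaled \<mu> t. w t x) = (LINT x|rescaled \<mu> t. w t x)"
      unfolding set_lebesgue_integral_def
    proof (rule integral_cong_AE)
      have r: "rescale t \<in> measurable (\<mu> t) (Cmeas 1)"
        using measurable_rescale_unit(1)[OF t0] t0 by (simp add: measurable_mu)
      have "{x \<in> space (Cmeas 1). x \<in> \<Union>R} = (\<Union>n. D n)"
        using R_subset D_Un by auto
      then have "{x \<in> space (Cmeas 1). x \<in> \<Union>R} \<in> sets (Cmeas 1)"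
        using Um sets_r by simp
      then have "AE x in rescaled \<mu> t. x \<in> \<Union>R"
        unfolding rescaled_def using AE_rescale_in_Union[OF e[OF t0] t0]
        by (subst AE_distr_iff[OF r])
      then show "AE x in rescaled \<mu> t. indicator (\<Union>n. D n) x *\<^sub>R w t x = w t x"
        unfolding D_Un by eventually_elim simp
    qed (use int[OF t0] Um in auto)
    ultimately show ?thesis by simp
  qed
  show ?thesis
  proof (rule borel_measurable_set_integral_generated[OF Int_stable_R _ _ sets_r _ _ _ A])
    show "R \<subseteq> Pow (space (Cmeas 1))" "sets (Cmeas 1) = sigma_sets (space (Cmeas 1)) R"
      using R_subset gen_R by simp_all
    show "integrable (rescaled \<mu> t) (w t)" if "t \<in> space pos_reals" for t
      using int that by simp
    show "(\<lambda>t. LINT x:B|rescaled \<mu> t. w t x) \<in> borel_measurable pos_reals" if "B \<in> R" for B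
      using gen[OF that] .
    show "(\<lambda>t. LINT x|rescaled \<mu> t. w t x) \<in> borel_measurable pos_reals"
      by (rule borel_measurable_LIMSEQ_real[where u = "\<lambda>n t. LINT x:D n|rescaled \<mu> t. w t x"])
        (fact lim, rule gen[OF D])
  qed
qed

lemma density_integral:
  fixes f :: "(real \<times> 'l) set \<Rightarrow> real"
  assumes t: "t > 0" and f: "integrable (\<mu> t) f" "\<And>Z. 0 \<le> f Z" and A: "A \<in> sets (Cmeas 1)"
  shows "measure (distr (density (\<mu> t) (\<lambda>Z. ennreal (f Z))) (Cmeas 1) (rescale t)) A =
    (LINT x:A|rescaled \<mu> t. f (rescale (1 / t) x))"
proof -
  have fm: "f \<in> borel_measurable (\<mu> t)" using f by auto
  have r: "rescale t \<in> measurable (\<mu> t) (Cmeas 1)"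
    using measurable_rescale_unit(1)[OF t] t by (simp add: measurable_mu)
  let ?B = "rescale t -` A \<inter> space (\<mu> t)"
  have B: "?B \<in> sets (\<mu> t)" by (rule measurable_sets[OF r A])
  have "emeasure (distr (density (\<mu> t) (\<lambda>Z. ennreal (f Z))) (Cmeas 1) (rescale t)) A =
      emeasure (density (\<mu> t) (\<lambda>Z. ennreal (f Z))) ?B"
    using A r by (subst emeasure_distr) auto
  also have "\<dots> = (\<integral>\<^sup>+Z. ennreal (f Z) * indicator ?B Z \<partial>\<mu> t)"
    using B fm by (intro emeasure_density) auto
  also have "\<dots> = (\<integral>\<^sup>+Z. ennreal (indicator A (rescale t Z) *\<^sub>R f Z) \<partial>\<mu> t)"
    by (intro nn_integral_cong) (auto simp: indicator_def)
  also have "\<dots> = ennreal (LINT Z|\<mu> t. indicator A (rescale t Z) *\<^sub>R f Z)"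
  proof (rule nn_integral_eq_integral)
    have "integrable (\<mu> t) (\<lambda>Z. indicator ?B Z *\<^sub>R f Z)"
      using B f(1) by (rule integrable_mult_indicator)
    then show "integrable (\<mu> t) (\<lambda>Z. indicator A (rescale t Z) *\<^sub>R f Z)"
      by (rule Bochner_Integration.integrable_cong[THEN iffD1, rotated 2]) (auto simp: indicator_def)
  qed (use f(2) in auto)
  also have "(LINT Z|\<mu> t. indicator A (rescale t Z) *\<^sub>R f Z) =
      (LINT x:A|rescaled \<mu> t. f (rescale (1 / t) x))"
    using fm t by (intro integral_rescaled[OF t _ A, symmetric]) (simp add: measurable_mu)
  finally show ?thesis
    using f(2) unfolding measure_def set_lebesgue_integral_def
    by (simp add: integral_nonneg_AE)
qed

section \<open>Units and convolution families\<close>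

definition convolution_family :: "(real \<Rightarrow> (real \<times> 'l) set measure) \<Rightarrow> bool" where
  "convolution_family \<nu> \<longleftrightarrow>
     (\<forall>t>0. prob_space (\<nu> t) \<and> \<nu> t \<in> space (prob_algebra (Cmeas t)))
   \<and> (\<forall>t>0. absolutely_continuous (\<mu> t) (\<nu> t))
   \<and> (\<forall>s>0. \<forall>t>0. \<nu> (s + t) = conv s t (\<nu> s) (\<nu> t))
   \<and> (\<forall>A\<in>R. (\<lambda>t. measure (distr (\<nu> t) (Cmeas 1) (rescale t)) A) \<in> borel_measurable pos_reals)"

text \<open>Absolute continuity is where the atom enters: a null set cannot contain the empty set.
  Unions and rescaling preserve emptiness, which gives the convolution identity and makes the
  measures constant in \<open>t\<close> after rescaling.\<close>

lemma convolution_family_empty: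
  assumes "t0 > 0" "emeasure (\<mu> t0) {{}} \<noteq> 0"
  shows "convolution_family (\<lambda>t. return (Cmeas t) {})"
  unfolding convolution_family_def
proof (intro conjI allI impI ballI)
  have pos: "emeasure (\<mu> t) {{}} \<noteq> 0" if "t > 0" for t
    using divisible_semigroup_pred[where P = "\<lambda>t. emeasure (\<mu> t) {{}} \<noteq> 0"] empty_atom_iff assms that
    by blast
  fix t :: real assume t: "t > 0"
  show ps: "prob_space (return (Cmeas t) ({} :: (real \<times> 'l) set))"
    by (rule prob_space_return) simp
  then show "return (Cmeas t) ({} :: (real \<times> 'l) set) \<in> space (prob_algebra (Cmeas t))"
    by (simp add: space_prob_algebra)
  show "absolutely_continuous (\<mu> t) (return (Cmeas t) {})"
    unfolding absolutely_continuous_def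
  proof
    fix A assume A: "A \<in> null_sets (\<mu> t)"
    have "{} \<notin> A"
    proof
      assume "{} \<in> A"
      then have "emeasure (\<mu> t) {{}} \<le> emeasure (\<mu> t) A"
        using A by (intro emeasure_mono) auto
      then show False using A pos[OF t] by auto
    qed
    then show "A \<in> null_sets (return (Cmeas t) {})"
      using A t by (simp add: null_sets_def sets_mu)
  qed
next
  fix s t :: real assume st: "s > 0" "t > 0"
  interpret s: prob_space "return (Cmeas s) ({} :: (real \<times> 'l) set)"
    by (rule prob_space_return) simp
  interpret t: prob_space "return (Cmeas t) ({} :: (real \<times> 'l) set)"
    by (rule prob_space_return) simp
  let ?P = "return (Cmeas s) ({} :: (real \<times> 'l) set) \<Otimes>\<^sub>M return (Cmeas t) ({} :: (real \<times> 'l) set)"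
  interpret pair_prob_space "return (Cmeas s) ({} :: (real \<times> 'l) set)" "return (Cmeas t) ({} :: (real \<times> 'l) set)" ..
  have o: "oplus s \<in> measurable ?P (Cmeas (s + t) :: (real \<times> 'l) set measure)"
    unfolding measurable_cong_sets[OF sets_pair_measure_cong[OF sets_return sets_return] refl]
    by (rule measurable_oplus[OF lc st])
  have "emeasure ?P ({{}} \<times> {{}}) = 1"
    using empty_sets by (subst t.emeasure_pair_measure_Times) auto
  then have "AE p in ?P. p \<in> {{}} \<times> {{}}"
    using empty_sets by (intro AE_prob_1) (simp add: measure_def)
  then have AE: "AE p in ?P. oplus s p = {}"
    by eventually_elim (auto simp: oplus_def shift_def)
  show "return (Cmeas (s + t)) {} = conv s t (return (Cmeas s) {}) (return (Cmeas t) ({} :: (real \<times> 'l) set))"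
  proof (rule measure_eqI)
    fix A :: "(real \<times> 'l) set set" assume "A \<in> sets (return (Cmeas (s + t)) {})"
    then have A: "A \<in> sets (Cmeas (s + t))" by simp
    have "emeasure (conv s t (return (Cmeas s) {}) (return (Cmeas t) {})) A =
        emeasure ?P (oplus s -` A \<inter> space ?P)"
      unfolding conv_def by (rule emeasure_distr[OF o A])
    also have "\<dots> = emeasure ?P ((\<lambda>_. {}) -` A \<inter> space ?P)"
    proof (rule emeasure_eq_AE)
      show "oplus s -` A \<inter> space ?P \<in> sets ?P"
        by (rule measurable_sets[OF o A])
      show "(\<lambda>_. {}) -` A \<inter> space ?P \<in> sets ?P"
      proof (cases "{} \<in> A")
        case True
        then have "(\<lambda>_. {}) -` A \<inter> space ?P = space ?P" by auto
        then show ?thesis using sets.top[of ?P] by argo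
      next
        case False
        then have "(\<lambda>_. {}) -` A \<inter> space ?P = {}" by auto
        then show ?thesis using sets.empty_sets[of ?P] by argo
      qed
      show "AE p in ?P. (p \<in> oplus s -` A \<inter> space ?P) = (p \<in> (\<lambda>_. {}) -` A \<inter> space ?P)"
        using AE by eventually_elim auto
    qed
    also have "\<dots> = indicator A {}"
      using emeasure_space_1 by (auto simp: indicator_def)
    finally show "emeasure (return (Cmeas (s + t)) {}) A =
        emeasure (conv s t (return (Cmeas s) {}) (return (Cmeas t) {})) A"
      using A by simp
  qed (simp add: conv_def)
next
  fix A assume A: "A \<in> R"
  have "measure (distr (return (Cmeas t) {}) (Cmeas 1) (rescale t)) A = indicator A {}"
    if "t \<in> space pos_reals" for t
  proof -
    have t: "t > 0" using that by simp
    have "distr (return (Cmeas t) ({} :: (real \<times> 'l) set)) (Cmeas 1) (rescale t) =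
        return (Cmeas 1) (rescale t {})"
      by (rule distr_return[OF measurable_rescale_unit(1)[OF t]]) simp
    then show ?thesis
      using R_sets[OF A] by (simp add: measure_return rescale_def)
  qed
  then show "(\<lambda>t. measure (distr (return (Cmeas t) {}) (Cmeas 1) (rescale t)) A) \<in> borel_measurable pos_reals"
    by (subst measurable_cong[where g = "\<lambda>_. indicator A {}"]) (assumption, simp)
qed

lemma convolution_family_of_unit:
  assumes u: "is_unit \<mu> R u" and e: "\<And>t. t > 0 \<Longrightarrow> emeasure (\<mu> t) {{}} = 0"
  shows "\<exists>\<nu>. convolution_family \<nu>"
proof -
  have um: "u t \<in> borel_measurable (\<mu> t)" and u2: "integrable (\<mu> t) (\<lambda>Z. (norm (u t Z))\<^sup>2)"
    if "t > 0" for t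
    using u that by (auto simp: is_unit_def)
  have uR: "(\<lambda>t. LINT Z|\<mu> t. u t Z * indicator A (rescale t Z)) \<in> borel_measurable pos_reals"
    if "A \<in> R" for A
    using u that by (auto simp: is_unit_def)
  have ueq: "AE Z in \<mu> (s + t). u (s + t) Z = complex_of_real (sqrt (Delta \<mu> s t Z))
                      * u s (left_piece s Z) * u t (right_piece s t Z)" if "s > 0" "t > 0" for s t
    using u that by (auto simp: is_unit_def)
  define f where "f t Z = (norm (u t Z))\<^sup>2" for t Z
  \<comment> \<open>The squared norm of the unit and the normalising factor. It must be shown
    multiplicative, positive and Borel in \<open>t\<close>.\<close>
  define n where "n t = (LINT Z|\<mu> t. f t Z)" for t
  have fm: "f t \<in> borel_measurable (\<mu> t)" if "t > 0" for t
    unfolding f_def using um[OF that] by measurable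
  have fi: "integrable (\<mu> t) (f t)" if "t > 0" for t
    unfolding f_def using u2[OF that] .
  have f_nn: "0 \<le> f t Z" for t Z by (simp add: f_def)
  have feq: "AE Z in \<mu> (s + t). f (s + t) Z =
      Delta \<mu> s t Z * (f s (left_piece s Z) * f t (right_piece s t Z))" if st: "s > 0" "t > 0" for s t
    using ueq[OF st]
  proof eventually_elim
    case (elim Z)
    have "0 \<le> Delta \<mu> s t Z" by (simp add: Delta_def)
    then show ?case
      unfolding f_def elim by (simp add: norm_mult power_mult_distrib)
  qed
  have mass: "emeasure (density (\<mu> t) (\<lambda>Z. ennreal (c * f t Z))) (Cspace t) = ennreal (c * n t)"
    if t: "t > 0" and c: "c \<ge> 0" for t c
  proof -
    have "emeasure (density (\<mu> t) (\<lambda>Z. ennreal (c * f t Z))) (space (\<mu> t)) =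
        (\<integral>\<^sup>+Z. ennreal (c * f t Z) \<partial>\<mu> t)"
      using fm[OF t] by (subst emeasure_density) (auto intro!: nn_integral_cong)
    also have "\<dots> = ennreal (LINT Z|\<mu> t. c * f t Z)"
      using fi[OF t] c f_nn by (intro nn_integral_eq_integral) auto
    finally show ?thesis using t by (simp add: n_def space_mu)
  qed
  have fin: "finite_measure (density (\<mu> t) (\<lambda>Z. ennreal (c * f t Z)))" if t: "t > 0" and c: "c \<ge> 0" for t c
    using mass[OF t c] t by (intro finite_measureI) (simp add: space_mu)
  \<comment> \<open>The constants stay free because the identity is used twice: with
    \<open>a = b = 1\<close> to see that \<open>n\<close> is multiplicative, then with the
    reciprocals of \<open>n s\<close> and \<open>n t\<close> for the normalised measures.\<close>
  have conv: "conv s t (density (\<mu> s) (\<lambda>Z. ennreal (a * f s Z))) (density (\<mu> t) (\<lambda>Z. ennreal (b * f t Z)))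
      = density (\<mu> (s + t)) (\<lambda>Z. ennreal ((a * b) * f (s + t) Z))"
    if st: "s > 0" "t > 0" and ab: "a \<ge> 0" "b \<ge> 0" for s t a b
  proof -
    have F: "(\<lambda>Z. ennreal (a * f s Z)) \<in> borel_measurable (Cmeas s)"
      and H: "(\<lambda>Z. ennreal (b * f t Z)) \<in> borel_measurable (Cmeas t)"
      using fm[OF st(1)] fm[OF st(2)] st by (auto simp: measurable_mu)
    have D: "Delta \<mu> s t \<in> borel_measurable (Cmeas (s + t))"
      by (rule Delta_measurable[OF st])
    have "conv s t (density (\<mu> s) (\<lambda>Z. ennreal (a * f s Z))) (density (\<mu> t) (\<lambda>Z. ennreal (b * f t Z)))
      = density (\<mu> (s + t)) (\<lambda>Z. ennreal (Delta \<mu> s t Z) *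
        (ennreal (a * f s (left_piece s Z)) * ennreal (b * f t (right_piece s t Z))))"
      by (intro conv_density st F H finite_measure.sigma_finite_measure fin ab)
    also have "\<dots> = density (\<mu> (s + t)) (\<lambda>Z. ennreal ((a * b) * f (s + t) Z))"
    proof (rule density_cong)
      show "(\<lambda>Z. ennreal (Delta \<mu> s t Z) *
        (ennreal (a * f s (left_piece s Z)) * ennreal (b * f t (right_piece s t Z)))) \<in>
          borel_measurable (\<mu> (s + t))"
        using measurable_compose[OF measurable_left_piece[OF lc, of s "s + t"] F]
          measurable_compose[OF measurable_right_piece[OF lc, of s t "s + t"] H] D st
        by (simp add: measurable_mu)
      show "(\<lambda>Z. ennreal ((a * b) * f (s + t) Z)) \<in> borel_measurable (\<mu> (s + t))"
        using fm[of "s + t"] st by simp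
      show "AE Z in \<mu> (s + t). ennreal (Delta \<mu> s t Z) *
        (ennreal (a * f s (left_piece s Z)) * ennreal (b * f t (right_piece s t Z))) =
          ennreal ((a * b) * f (s + t) Z)"
        using feq[OF st]
      proof eventually_elim
        case (elim Z)
        have "0 \<le> Delta \<mu> s t Z" by (simp add: Delta_def)
        then show ?case
          unfolding elim using ab f_nn by (simp add: ennreal_mult[symmetric] ac_simps)
      qed
    qed
    finally show ?thesis .
  qed
  have n_nn: "0 \<le> n t" for t
    unfolding n_def using f_nn by (intro integral_nonneg_AE) auto
  have n_mult: "n (s + t) = n s * n t" if st: "s > 0" "t > 0" for s t
  proof -
    have "ennreal (n (s + t)) = emeasure (density (\<mu> (s + t)) (\<lambda>Z. ennreal (f (s + t) Z))) (Cspace (s + t))"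
      using mass[of "s + t" 1] st by simp
    also have "\<dots> = emeasure (conv s t (density (\<mu> s) (\<lambda>Z. ennreal (1 * f s Z)))
        (density (\<mu> t) (\<lambda>Z. ennreal (1 * f t Z)))) (Cspace (s + t))"
      unfolding conv[OF st zero_le_one zero_le_one] by simp
    also have "\<dots> = ennreal (1 * n s) * ennreal (1 * n t)"
      using st fin[OF st(2), of 1] unfolding mass[OF st(1) zero_le_one, symmetric] mass[OF st(2) zero_le_one, symmetric]
      by (intro emeasure_conv_space[OF st]) (auto simp: sets_mu intro: finite_measure.sigma_finite_measure)
    finally have "ennreal (n (s + t)) = ennreal (n s * n t)"
      using n_nn by (simp add: ennreal_mult)
    then show ?thesis
      using n_nn by (simp add: ennreal_inj)
  qed
  obtain t0 where t0: "t0 > 0" "\<not> (AE Z in \<mu> t0. u t0 Z = 0)"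
    using u by (auto simp: is_unit_def)
  have "n t0 \<noteq> 0"
  proof
    assume "n t0 = 0"
    then have "AE Z in \<mu> t0. f t0 Z = 0"
      using integral_nonneg_eq_0_iff_AE[OF fi[OF t0(1)]] f_nn by (simp add: n_def)
    then have "AE Z in \<mu> t0. u t0 Z = 0"
      by eventually_elim (simp add: f_def)
    with t0 show False by simp
  qed
  then have n_pos: "n t > 0" if "t > 0" for t
    using divisible_semigroup_pred[where P = "\<lambda>t. n t \<noteq> 0", OF _ _ t0(1) that] n_mult n_nn[of t]
    by (simp add: less_le)
  define \<nu> where "\<nu> t = density (\<mu> t) (\<lambda>Z. ennreal (1 / n t * f t Z))" for t
  have sets_nu: "sets (\<nu> t) = sets (Cmeas t)" if "t > 0" for t
    using that by (simp add: \<nu>_def sets_mu)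
  have prob_nu: "prob_space (\<nu> t)" if t: "t > 0" for t
  proof
    show "emeasure (\<nu> t) (space (\<nu> t)) = 1"
      using mass[OF t, of "1 / n t"] n_pos[OF t] t by (simp add: \<nu>_def space_mu)
  qed
  have meas_nu: "(\<lambda>t. measure (distr (\<nu> t) (Cmeas 1) (rescale t)) A) \<in> borel_measurable pos_reals"
    if A: "A \<in> R" for A
  proof -
    interpret m: measure_field pos_reals "Cmeas 1" "rescaled \<mu>" alg_R
      by (rule measure_field_mu)
    define v where "v t x = u t (rescale (1 / t) x)" for t x
    have ui: "integrable (\<mu> t) (u t)" if t: "t > 0" for t
    proof -
      interpret prob_space "\<mu> t" by (rule prob[OF t])
      have "integrable (\<mu> t) (\<lambda>Z. norm (u t Z))"
        by (rule square_integrable_imp_integrable[OF measurable_compose[OF um[OF t] borel_measurable_norm] u2[OF t]])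
      then show ?thesis
        by (rule integrable_norm_cancel[OF _ um[OF t]])
    qed
    \<comment> \<open>The square lemma is about real sections, so the unit is tested through a
      real-linear \<open>g\<close>, later \<open>Re\<close> and \<open>Im\<close>. Being bounded
      linear, \<open>g\<close> commutes with the integrals that are Borel by hypothesis, and
      \<open>g_le\<close> keeps the squares integrable.\<close>
    have sq_section: "m.borel_section (\<lambda>t x. (g (v t x))\<^sup>2)" and
      sq_int: "\<And>t. t > 0 \<Longrightarrow> integrable (rescaled \<mu> t) (\<lambda>x. (g (v t x))\<^sup>2)"
      if g: "bounded_linear g" and g_le: "\<And>z. (g z)\<^sup>2 \<le> (norm z)\<^sup>2" for g :: "complex \<Rightarrow> real"
    proof -
      have gm: "g \<in> borel_measurable borel"
        using g by (intro borel_measurable_continuous_onI linear_continuous_on)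
      have gum: "(\<lambda>Z. g (u t Z)) \<in> borel_measurable (\<mu> t)" if "t > 0" for t
        by (rule measurable_compose[OF um[OF that] gm])
      show sq_int: "integrable (rescaled \<mu> t) (\<lambda>x. (g (v t x))\<^sup>2)" if t: "t > 0" for t
        unfolding v_def
      proof (rule integrable_rescaled[OF t])
        show "integrable (\<mu> t) (\<lambda>Z. (g (u t Z))\<^sup>2)"
          using u2[OF t] by (rule Bochner_Integration.integrable_bound)
            (use gum[OF t] g_le in auto)
      qed
      have gvm: "(\<lambda>x. g (v t x)) \<in> borel_measurable (Cmeas 1)" if t: "t > 0" for t
      proof -
        have "(\<lambda>Z. g (u t Z)) \<in> borel_measurable (Cmeas t)"
          using gum[OF t] t by (simp add: measurable_mu)
        from measurable_compose[OF measurable_rescale_unit(2)[OF t] this] show ?thesis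
          by (simp add: v_def)
      qed
      show "m.borel_section (\<lambda>t x. (g (v t x))\<^sup>2)"
      proof (rule m.borel_section_square)
        show "m.borel_section (\<lambda>t x. g (v t x))"
          unfolding m.borel_section_def
        proof
          fix B :: "(real \<times> 'l) set set" assume B: "B \<in> sets (Cmeas 1)"
          show "(\<lambda>t. LINT x:B|rescaled \<mu> t. g (v t x)) \<in> borel_measurable pos_reals"
          \<comment> \<open>Here the absence of an atom at the empty set is used, to pass from tests
            on the ring to all measurable sets.\<close>
          proof (rule section_from_ring[OF e _ _ B])
            show "integrable (rescaled \<mu> t) (\<lambda>x. g (v t x))" if t: "t > 0" for t
              unfolding v_def using integrable_bounded_linear[OF g ui[OF t]]
              by (intro integrable_rescaled[OF t])
            fix C assume C: "C \<in> R"
            have "(LINT x:C|rescaled \<mu> t. g (v t x)) = g (LINT Z|\<mu> t. u t Z * indicator C (rescale t Z))"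
              if "t \<in> space pos_reals" for t
            proof -
              have t: "t > 0" using that by simp
              have "(LINT x:C|rescaled \<mu> t. g (v t x)) = (LINT x:C|rescaled \<mu> t. g (u t (rescale (1 / t) x)))"
                by (simp add: v_def)
              also have "\<dots> = (LINT Z|\<mu> t. indicator C (rescale t Z) *\<^sub>R g (u t Z))"
                using gum[OF t] t by (intro integral_rescaled[OF t _ R_sets[OF C]]) (simp add: measurable_mu)
              also have "\<dots> = (LINT Z|\<mu> t. g (u t Z * indicator C (rescale t Z)))"
                using linear_simps(3)[OF g] bounded_linear.linear[OF g]
                by (intro Bochner_Integration.integral_cong) (auto simp: indicator_def linear_0)
              also have "\<dots> = g (LINT Z|\<mu> t. u t Z * indicator C (rescale t Z))"
              proof (rule integral_bounded_linear[OF g])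
                have r: "rescale t \<in> measurable (\<mu> t) (Cmeas 1)"
                  using measurable_rescale_unit(1)[OF t] t by (simp add: measurable_mu)
                have "(\<lambda>Z. u t Z * indicator C (rescale t Z)) \<in> borel_measurable (\<mu> t)"
                  using um[OF t] measurable_compose[OF r borel_measurable_indicator[OF R_sets[OF C]]]
                  by (rule borel_measurable_times)
                then show "integrable (\<mu> t) (\<lambda>Z. u t Z * indicator C (rescale t Z))"
                  by (rule Bochner_Integration.integrable_bound[OF ui[OF t]])
                    (auto simp: indicator_def)
              qed
              finally show ?thesis .
            qed
            then show "(\<lambda>t. LINT x:C|rescaled \<mu> t. g (v t x)) \<in> borel_measurable pos_reals"
              using measurable_compose[OF uR[OF C] gm]
              by (subst measurable_cong[where
                    g = "\<lambda>t. g (LINT Z|\<mu> t. u t Z * indicator C (rescale t Z))"])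
          qed
        qed
      qed (use gvm sq_int in auto)
    qed
    have Re: "(Re z)\<^sup>2 \<le> (norm z)\<^sup>2" and Im: "(Im z)\<^sup>2 \<le> (norm z)\<^sup>2" for z
      by (simp_all add: cmod_power2)
    have sec_f: "m.borel_section (\<lambda>t x. f t (rescale (1 / t) x))"
    proof -
      have "m.borel_section (\<lambda>t x. (Re (v t x))\<^sup>2 + (Im (v t x))\<^sup>2)"
        using sq_section[OF bounded_linear_Re Re] sq_section[OF bounded_linear_Im Im]
          sq_int[OF bounded_linear_Re Re] sq_int[OF bounded_linear_Im Im]
        by (intro m.borel_section_add) auto
      then show ?thesis
        by (simp add: f_def v_def cmod_power2)
    qed
    have n_eq: "n t = (LINT x:Cspace 1|rescaled \<mu> t. f t (rescale (1 / t) x))" if t: "t > 0" for t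
    proof -
      have fm': "f t \<in> borel_measurable (Cmeas t)"
        using fm[OF t] t by (simp add: measurable_mu)
      have "(LINT x:Cspace 1|rescaled \<mu> t. f t (rescale (1 / t) x)) =
          (LINT Z|\<mu> t. indicator (Cspace 1) (rescale t Z) *\<^sub>R f t Z)"
        using sets.top[of "Cmeas 1 :: (real \<times> 'l) set measure"]
        by (intro integral_rescaled[OF t fm']) simp
      also have "\<dots> = n t"
        unfolding n_def using t
        by (intro Bochner_Integration.integral_cong) (auto simp: space_mu rescale_in_Cspace)
      finally show ?thesis by simp
    qed
    \<comment> \<open>The norm is an integral over the whole space, which may lie outside
      \<open>R\<close>; this is why the section had to be Borel for the full sigma-field.\<close>
    have n_meas: "n \<in> borel_measurable pos_reals"
    proof (subst measurable_cong)
      show "n t = (LINT x:space (Cmeas 1)|rescaled \<mu> t. f t (rescale (1 / t) x))"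
        if "t \<in> space pos_reals" for t
        using n_eq[of t] that by simp
      show "(\<lambda>t. LINT x:space (Cmeas 1)|rescaled \<mu> t. f t (rescale (1 / t) x)) \<in> borel_measurable pos_reals"
        by (rule m.borel_sectionD[OF sec_f sets.top])
    qed
    have "measure (distr (\<nu> t) (Cmeas 1) (rescale t)) A =
        1 / n t * (LINT x:A|rescaled \<mu> t. f t (rescale (1 / t) x))" if "t \<in> space pos_reals" for t
    proof -
      have t: "t > 0" using that by simp
      have "measure (distr (\<nu> t) (Cmeas 1) (rescale t)) A =
          (LINT x:A|rescaled \<mu> t. 1 / n t * f t (rescale (1 / t) x))"
        unfolding \<nu>_def using fi[OF t] f_nn n_nn
        by (intro density_integral[OF t _ _ R_sets[OF A]]) auto
      then show ?thesis by simp
    qed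
    moreover have "(\<lambda>t. 1 / n t * (LINT x:A|rescaled \<mu> t. f t (rescale (1 / t) x))) \<in> borel_measurable pos_reals"
      using n_meas m.borel_sectionD[OF sec_f R_sets[OF A]] by measurable
    ultimately show ?thesis
      by (subst measurable_cong[where
            g = "\<lambda>t. 1 / n t * (LINT x:A|rescaled \<mu> t. f t (rescale (1 / t) x))"])
  qed
  have "convolution_family \<nu>"
    unfolding convolution_family_def
  proof (intro conjI allI impI ballI)
    fix t :: real assume t: "t > 0"
    show "prob_space (\<nu> t)" by (rule prob_nu[OF t])
    then show "\<nu> t \<in> space (prob_algebra (Cmeas t))"
      using sets_nu[OF t] by (simp add: space_prob_algebra)
    show "absolutely_continuous (\<mu> t) (\<nu> t)"
      unfolding \<nu>_def using fm[OF t] by (intro absolutely_continuousI_density) auto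
  next
    fix s t :: real assume st: "s > 0" "t > 0"
    show "\<nu> (s + t) = conv s t (\<nu> s) (\<nu> t)"
      unfolding \<nu>_def using conv[OF st, of "1 / n s" "1 / n t"] n_nn n_mult[OF st] by simp
  qed (rule meas_nu)
  then show ?thesis by blast
qed

text \<open>The densities of \<open>\<nu>\<close> satisfy the square of the unit equation, so their
  nonnegative roots satisfy the equation itself. The work lies in the Borel condition, as the
  derivatives are chosen independently at each time.\<close>

lemma unit_of_convolution_family:
  assumes \<nu>: "convolution_family \<nu>"
  shows "\<exists>u. is_unit \<mu> R u"
proof -
  have prob_nu: "prob_space (\<nu> t)" and sets_nu: "sets (\<nu> t) = sets (Cmeas t)"
    and ac: "absolutely_continuous (\<mu> t) (\<nu> t)" if "t > 0" for t
    using \<nu> that by (auto simp: convolution_family_def space_prob_algebra)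
  have conv: "\<nu> (s + t) = conv s t (\<nu> s) (\<nu> t)" if "s > 0" "t > 0" for s t
    using \<nu> that by (auto simp: convolution_family_def)
  define f where "f t Z = enn2real (RN_deriv (\<mu> t) (\<nu> t) Z)" for t Z
  have f_nn: "0 \<le> f t Z" for t Z by (simp add: f_def)
  have fm: "f t \<in> borel_measurable (\<mu> t)" for t
    unfolding f_def by measurable
  have fm': "f t \<in> borel_measurable (Cmeas t)" if "t > 0" for t
    using fm[of t] that by (simp add: measurable_mu)
  have dens: "density (\<mu> t) (\<lambda>Z. ennreal (f t Z)) = \<nu> t" if t: "t > 0" for t
  proof -
    interpret prob_space "\<mu> t" by (rule prob[OF t])
    interpret n: prob_space "\<nu> t" by (rule prob_nu[OF t])
    have s: "sets (\<nu> t) = sets (\<mu> t)"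
      using t by (simp add: sets_nu sets_mu)
    have "AE Z in \<mu> t. RN_deriv (\<mu> t) (\<nu> t) Z \<noteq> \<infinity>"
      by (rule RN_deriv_finite[OF n.sigma_finite_measure_axioms ac[OF t] s])
    then have "AE Z in \<mu> t. ennreal (f t Z) = RN_deriv (\<mu> t) (\<nu> t) Z"
      by eventually_elim (simp add: f_def top.not_eq_extremum)
    then have "density (\<mu> t) (\<lambda>Z. ennreal (f t Z)) = density (\<mu> t) (RN_deriv (\<mu> t) (\<nu> t))"
      using fm[of t] by (intro density_cong) auto
    then show ?thesis
      using density_RN_deriv[OF ac[OF t] s] by simp
  qed
  have nn_int: "(\<integral>\<^sup>+Z. ennreal (f t Z) \<partial>\<mu> t) = 1" if t: "t > 0" for t
  proof -
    interpret n: prob_space "\<nu> t" by (rule prob_nu[OF t])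
    have "emeasure (density (\<mu> t) (\<lambda>Z. ennreal (f t Z))) (space (\<mu> t)) = (\<integral>\<^sup>+Z. ennreal (f t Z) \<partial>\<mu> t)"
      using fm[of t] by (subst emeasure_density) (auto intro!: nn_integral_cong)
    then show ?thesis
      using n.emeasure_space_1 sets_eq_imp_space_eq[OF sets_nu[OF t]] t
      by (simp add: dens[OF t] space_mu)
  qed
  have fi: "integrable (\<mu> t) (f t)" if t: "t > 0" for t
    using fm[of t] f_nn nn_int[OF t] by (intro integrableI_nonneg) auto
  have feq: "AE Z in \<mu> (s + t). f (s + t) Z =
      Delta \<mu> s t Z * (f s (left_piece s Z) * f t (right_piece s t Z))" if st: "s > 0" "t > 0" for s t
  proof -
    have st': "s + t > 0" using st by simp
    interpret prob_space "\<mu> (s + t)" by (rule prob[OF st'])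
    interpret n: prob_space "\<nu> t" by (rule prob_nu[OF st(2)])
    have F: "(\<lambda>Z. ennreal (f s Z)) \<in> borel_measurable (Cmeas s)"
      and H: "(\<lambda>Z. ennreal (f t Z)) \<in> borel_measurable (Cmeas t)"
      using fm' st by auto
    let ?G = "\<lambda>Z. ennreal (Delta \<mu> s t Z) *
      (ennreal (f s (left_piece s Z)) * ennreal (f t (right_piece s t Z)))"
    have G: "?G \<in> borel_measurable (\<mu> (s + t))"
      using measurable_compose[OF measurable_left_piece[OF lc, of s "s + t"] F]
        measurable_compose[OF measurable_right_piece[OF lc, of s t "s + t"] H]
        Delta_measurable[OF st] st by (simp add: measurable_mu)
    have "conv s t (\<nu> s) (\<nu> t) = density (\<mu> (s + t)) ?G"
      using conv_density[OF st F H] dens st n.sigma_finite_measure_axioms by simp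
    then have eq: "density (\<mu> (s + t)) (\<lambda>Z. ennreal (f (s + t) Z)) = density (\<mu> (s + t)) ?G"
      using conv[OF st] dens[OF st'] by simp
    \<comment> \<open>Both are densities of \<open>\<nu> (s + t)\<close>, one by the choice of
      \<open>f\<close>, the other through the convolution identity, and densities are unique almost
      everywhere.\<close>
    have "AE Z in \<mu> (s + t). ennreal (f (s + t) Z) = ?G Z"
      using fm[of "s + t"] G eq by (intro density_unique) auto
    then show ?thesis
    proof eventually_elim
      case (elim Z)
      have D: "0 \<le> Delta \<mu> s t Z" by (simp add: Delta_def)
      have "ennreal (f (s + t) Z) =
          ennreal (Delta \<mu> s t Z * (f s (left_piece s Z) * f t (right_piece s t Z)))"
        unfolding elim using D f_nn by (simp add: ennreal_mult)
      then show ?case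
        using D f_nn by (simp add: ennreal_inj)
    qed
  qed
  define u where "u t Z = complex_of_real (sqrt (f t Z))" for t Z
  have "is_unit \<mu> R u"
    unfolding is_unit_def
  proof (intro conjI allI impI ballI)
    fix t :: real assume t: "t > 0"
    show "u t \<in> borel_measurable (\<mu> t)"
      unfolding u_def using fm[of t] by measurable
    show "integrable (\<mu> t) (\<lambda>Z. (norm (u t Z))\<^sup>2)"
      using fi[OF t] f_nn by (simp add: u_def)
  next
    fix s t :: real assume st: "s > 0" "t > 0"
    show "AE Z in \<mu> (s + t). u (s + t) Z = complex_of_real (sqrt (Delta \<mu> s t Z))
                      * u s (left_piece s Z) * u t (right_piece s t Z)"
      using feq[OF st] by eventually_elim (simp add: u_def real_sqrt_mult)
  next
    have "\<not> (AE Z in \<mu> 1. u 1 Z = 0)"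
    proof
      assume "AE Z in \<mu> 1. u 1 Z = 0"
      then have "AE Z in \<mu> 1. ennreal (f 1 Z) = 0"
        by eventually_elim (simp add: u_def)
      then have "(\<integral>\<^sup>+Z. ennreal (f 1 Z) \<partial>\<mu> 1) = 0"
        using fm[of 1] by (subst nn_integral_0_iff_AE) auto
      then show False using nn_int[of 1] by simp
    qed
    then show "\<exists>t>0. \<not> (AE Z in \<mu> t. u t Z = 0)"
      by (intro exI[of _ 1]) simp
  next
    fix A assume A: "A \<in> R"
    \<comment> \<open>Integrals of \<open>f\<close> are masses of \<open>\<nu>\<close>. As
      \<open>\<nu>\<close> consists of probability measures, their Borel dependence extends from
      \<open>R\<close> to the full sigma-field, with no case distinction on the atom.\<close>
    have field: "measure_field pos_reals (Cmeas 1) (rescaled \<nu>) alg_R"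
      using \<nu> by (intro measure_field_rescaled prob_nu sets_nu)
        (auto simp: convolution_family_def rescaled_def)
    have sec: "(\<lambda>t. LINT x:B|rescaled \<mu> t. f t (rescale (1 / t) x)) \<in> borel_measurable pos_reals"
      if B: "B \<in> sets (Cmeas 1)" for B
    proof -
      have "(LINT x:B|rescaled \<mu> t. f t (rescale (1 / t) x)) = measure (rescaled \<nu> t) B"
        if "t \<in> space pos_reals" for t
        using density_integral[of t "f t", OF _ _ f_nn B] fi[of t] that dens[of t]
        by (simp add: rescaled_def)
      then show ?thesis
        using measure_field.measurable_field[OF field B]
        by (subst measurable_cong[where g = "\<lambda>t. measure (rescaled \<nu> t) B"])
    qed
    have "(\<lambda>t. LINT x:A|rescaled \<mu> t. sqrt (f t (rescale (1 / t) x))) \<in> borel_measurable pos_reals"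
    proof (rule borel_measurable_integral_sqrt[OF measure_field_mu _ _ _ sec R_sets[OF A]])
      fix t :: real assume "t \<in> space pos_reals"
      then have t: "t > 0" by simp
      show "(\<lambda>x. f t (rescale (1 / t) x)) \<in> borel_measurable (Cmeas 1)"
        by (rule measurable_compose[OF measurable_rescale_unit(2)[OF t] fm'[OF t]])
      show "integrable (rescaled \<mu> t) (\<lambda>x. f t (rescale (1 / t) x))"
        by (rule integrable_rescaled[OF t fi[OF t]])
    qed (rule f_nn)
    then have "(\<lambda>t. complex_of_real (LINT x:A|rescaled \<mu> t. sqrt (f t (rescale (1 / t) x)))) \<in> borel_measurable pos_reals"
      by measurable
    moreover have "(LINT Z|\<mu> t. u t Z * indicator A (rescale t Z)) =
        complex_of_real (LINT x:A|rescaled \<mu> t. sqrt (f t (rescale (1 / t) x)))"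
      if "t \<in> space pos_reals" for t
    proof -
      have t: "t > 0" using that by simp
      have "(LINT x:A|rescaled \<mu> t. sqrt (f t (rescale (1 / t) x))) =
          (LINT Z|\<mu> t. indicator A (rescale t Z) *\<^sub>R sqrt (f t Z))"
        using fm'[OF t] by (intro integral_rescaled[OF t _ R_sets[OF A]]) measurable
      also have "complex_of_real \<dots> = (LINT Z|\<mu> t. complex_of_real (indicator A (rescale t Z) *\<^sub>R sqrt (f t Z)))"
        by (rule integral_complex_of_real[symmetric])
      also have "\<dots> = (LINT Z|\<mu> t. u t Z * indicator A (rescale t Z))"
        by (intro Bochner_Integration.integral_cong) (auto simp: u_def indicator_def)
      finally show ?thesis by simp
    qed
    ultimately show "(\<lambda>t. LINT Z|\<mu> t. u t Z * indicator A (rescale t Z)) \<in> borel_measurable pos_reals"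
      by (subst measurable_cong[where
            g = "\<lambda>t. complex_of_real (LINT x:A|rescaled \<mu> t. sqrt (f t (rescale (1 / t) x)))"])
  qed
  then show ?thesis by blast
qed

text \<open>If the empty set is an atom at some time, both sides hold: the point masses form a
  family, and this family yields a unit. Otherwise the normalised squared modulus of a unit is
  available.\<close>

lemma spatial_iff_convolution_family: "spatial \<mu> R \<longleftrightarrow> (\<exists>\<nu>. convolution_family \<nu>)"
  using convolution_family_empty convolution_family_of_unit unit_of_convolution_family
  unfolding spatial_def by blast

end

theorem theorem3p2:
  fixes \<mu> :: "real \<Rightarrow> (real \<times> 'l::{t2_space, second_countable_topology}) set measure"
    and R :: "(real \<times> 'l) set set set"
  assumes "locally_compact_space (euclidean :: 'l topology)"
    and "measurable_factorizing_family \<mu> R"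
  shows "spatial \<mu> R \<longleftrightarrow>
    (\<exists>\<nu> :: real \<Rightarrow> (real \<times> 'l) set measure.
        (\<forall>t>0. prob_space (\<nu> t) \<and> \<nu> t \<in> space (prob_algebra (Cmeas t)))
      \<and> (\<forall>t>0. absolutely_continuous (\<mu> t) (\<nu> t))
      \<and> (\<forall>s>0. \<forall>t>0. \<nu> (s + t) = conv s t (\<nu> s) (\<nu> t))
      \<and> (\<forall>A\<in>R. (\<lambda>t. measure (distr (\<nu> t) (Cmeas 1) (rescale t)) A) \<in> borel_measurable pos_reals))"
proof -
  interpret factorizing_family \<mu> R
    using assms by unfold_locales
  show ?thesis
    using spatial_iff_convolution_family unfolding convolution_family_def .
qed

end
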